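(* Let $f:A \rightarrow A$ be an isogeny of a complex abelian variety $A$. Then the following three conditions are equivalent: (1) $\operatorname{Preper}(f) \neq \operatorname{Tors}(A)$; (2) there is a positive-dimensional abelian subvariety of $A$ that is pointwise fixed by some iterate $f^k$ ($k\geq 1$); and (3) there is an eigenvalue of $f^*$ on $H^{1,0}(A)$ that is a root of unity.
   Context: $\operatorname{Tors}(A)$ denotes the set of torsion points of $A$. $\operatorname{Preper}(f)$ denotes the set of points of $A$ that are preperiodic for $f$, i.e. points $P$ with $f^m(P)=f^n(P)$ for some integers $m>n\geq 0$. An abelian subvariety of $A$ is a reduced and irreducible group subvariety. An isogeny $A\to A$ is a surjective group homomorphism (with finite kernel) that is a morphism of varieties. *)

theory Defs
  imports
    "HOL-Analysis.Analysis"
    "HOL-Algebra.Coset"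
    "HOL-Library.Extended_Nat"
begin

text \<open>
  A complex abelian variety is a complex torus \<open>A = V/L\<close> that admits a polarization, where \<open>V\<close> is
  a finite-dimensional complex vector space and \<open>L\<close> a lattice in \<open>V\<close>. Being projective, \<open>A\<close> obeys
  Chow's theorem and GAGA: its algebraic subvarieties are its closed analytic subsets, and the
  morphisms of varieties \<open>A \<rightarrow> A\<close> are the holomorphic maps. Analytic objects on \<open>A\<close> are described in
  the charts given by the local inverses of the quotient map \<open>V \<rightarrow> A\<close>.

  The type \<open>'v\<close> is \<open>V\<close>, with complex scalar multiplication \<open>sc\<close>. The norm serves only to provide
  the topology, for which the choice is immaterial. \<open>V = 0\<close> is allowed.
\<close>

definition fin_dim_complex_space :: "(complex \<Rightarrow> 'v::real_normed_vector \<Rightarrow> 'v) \<Rightarrow> bool" where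
  "fin_dim_complex_space sc \<longleftrightarrow>
     vector_space sc \<and>
     (\<forall>r x. sc (complex_of_real r) x = r *\<^sub>R x) \<and>
     (\<exists>B. finite B \<and> module.span sc B = UNIV)"

definition holomorphic_map ::
    "(complex \<Rightarrow> 'v::real_normed_vector \<Rightarrow> 'v) \<Rightarrow> (complex \<Rightarrow> 'w::real_normed_vector \<Rightarrow> 'w)
      \<Rightarrow> 'v set \<Rightarrow> ('v \<Rightarrow> 'w) \<Rightarrow> bool" where
  "holomorphic_map sc sc' U h \<longleftrightarrow>
     open U \<and> (\<forall>x\<in>U. \<exists>D. (h has_derivative D) (at x) \<and> Vector_Spaces.linear sc sc' D)"


subsection \<open>Complex tori and abelian varieties\<close>

definition additive_group :: "'v::ab_group_add monoid" where
  "additive_group = \<lparr>carrier = UNIV, mult = (+), one = 0\<rparr>"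

definition is_lattice :: "'v::real_normed_vector set \<Rightarrow> bool" where
  "is_lattice L \<longleftrightarrow> subgroup L additive_group \<and> discrete L \<and> span L = UNIV"

definition torus :: "'v::real_normed_vector set \<Rightarrow> 'v set monoid" where
  "torus L = additive_group Mod L"

definition proj :: "'v::real_normed_vector set \<Rightarrow> 'v \<Rightarrow> 'v set" where
  "proj L x = L #>\<^bsub>additive_group\<^esub> x"

text \<open>A positive definite Hermitian form whose imaginary part is integral on the lattice.\<close>

definition polarization ::
    "(complex \<Rightarrow> 'v::real_normed_vector \<Rightarrow> 'v) \<Rightarrow> 'v set \<Rightarrow> ('v \<Rightarrow> 'v \<Rightarrow> complex) \<Rightarrow> bool" where
  "polarization sc L H \<longleftrightarrow>
     (\<forall>y. Vector_Spaces.linear sc (*) (\<lambda>x. H x y)) \<and>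
     (\<forall>x y. H y x = cnj (H x y)) \<and>
     (\<forall>x. x \<noteq> 0 \<longrightarrow> Re (H x x) > 0) \<and>
     (\<forall>l\<in>L. \<forall>m\<in>L. Im (H l m) \<in> \<int>)"

definition abelian_variety ::
    "(complex \<Rightarrow> 'v::real_normed_vector \<Rightarrow> 'v) \<Rightarrow> 'v set \<Rightarrow> bool" where
  "abelian_variety sc L \<longleftrightarrow>
     fin_dim_complex_space sc \<and> is_lattice L \<and> (\<exists>H. polarization sc L H)"


subsection \<open>Isogenies\<close>

definition local_lift ::
    "(complex \<Rightarrow> 'v::real_normed_vector \<Rightarrow> 'v) \<Rightarrow> 'v set \<Rightarrow> ('v set \<Rightarrow> 'v set)
      \<Rightarrow> 'v set \<Rightarrow> ('v \<Rightarrow> 'v) \<Rightarrow> bool" where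
  "local_lift sc L f U F \<longleftrightarrow>
     holomorphic_map sc sc U F \<and> (\<forall>y\<in>U. f (proj L y) = proj L (F y))"

definition morphism ::
    "(complex \<Rightarrow> 'v::real_normed_vector \<Rightarrow> 'v) \<Rightarrow> 'v set \<Rightarrow> ('v set \<Rightarrow> 'v set) \<Rightarrow> bool" where
  "morphism sc L f \<longleftrightarrow> (\<forall>x. \<exists>U F. x \<in> U \<and> local_lift sc L f U F)"

definition isogeny ::
    "(complex \<Rightarrow> 'v::real_normed_vector \<Rightarrow> 'v) \<Rightarrow> 'v set \<Rightarrow> ('v set \<Rightarrow> 'v set) \<Rightarrow> bool" where
  "isogeny sc L f \<longleftrightarrow>
     f \<in> hom (torus L) (torus L) \<and>
     f ` carrier (torus L) = carrier (torus L) \<and>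
     finite (kernel (torus L) (torus L) f) \<and>
     morphism sc L f"


subsection \<open>Torsion and preperiodic points\<close>

definition Tors :: "'v::real_normed_vector set \<Rightarrow> 'v set set" where
  "Tors L = {P \<in> carrier (torus L). \<exists>n::nat. n > 0 \<and> P [^]\<^bsub>torus L\<^esub> n = \<one>\<^bsub>torus L\<^esub>}"

definition Preper :: "'v::real_normed_vector set \<Rightarrow> ('v set \<Rightarrow> 'v set) \<Rightarrow> 'v set set" where
  "Preper L f = {P \<in> carrier (torus L). \<exists>m n::nat. m > n \<and> (f ^^ m) P = (f ^^ n) P}"


subsection \<open>Abelian subvarieties\<close>

text \<open>
  The local equations are required near every point of \<open>A\<close>, not only near the points of \<open>Z\<close>,
  so such a \<open>Z\<close> is closed.
\<close>

definition closed_subvariety ::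
    "(complex \<Rightarrow> 'v::real_normed_vector \<Rightarrow> 'v) \<Rightarrow> 'v set \<Rightarrow> 'v set set \<Rightarrow> bool" where
  "closed_subvariety sc L Z \<longleftrightarrow>
     Z \<subseteq> carrier (torus L) \<and>
     (\<forall>x. \<exists>U E. x \<in> U \<and> open U \<and> finite E \<and> (\<forall>h\<in>E. holomorphic_map sc (*) U h) \<and>
        (\<forall>y\<in>U. proj L y \<in> Z \<longleftrightarrow> (\<forall>h\<in>E. h y = (0::complex))))"

definition irreducible_subvariety ::
    "(complex \<Rightarrow> 'v::real_normed_vector \<Rightarrow> 'v) \<Rightarrow> 'v set \<Rightarrow> 'v set set \<Rightarrow> bool" where
  "irreducible_subvariety sc L Z \<longleftrightarrow>
     closed_subvariety sc L Z \<and> Z \<noteq> {} \<and>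
     (\<forall>Z1 Z2. closed_subvariety sc L Z1 \<and> closed_subvariety sc L Z2 \<and> Z = Z1 \<union> Z2
        \<longrightarrow> Z = Z1 \<or> Z = Z2)"

text \<open>The Krull dimension; for an algebraic variety over a field this is its dimension.\<close>

definition subvariety_dim ::
    "(complex \<Rightarrow> 'v::real_normed_vector \<Rightarrow> 'v) \<Rightarrow> 'v set \<Rightarrow> 'v set set \<Rightarrow> enat" where
  "subvariety_dim sc L Z =
     Sup {enat n | n. \<exists>C::nat \<Rightarrow> 'v set set.
        (\<forall>i\<le>n. irreducible_subvariety sc L (C i) \<and> C i \<subseteq> Z) \<and> (\<forall>i<n. C i \<subset> C (Suc i))}"

definition abelian_subvariety ::
    "(complex \<Rightarrow> 'v::real_normed_vector \<Rightarrow> 'v) \<Rightarrow> 'v set \<Rightarrow> 'v set set \<Rightarrow> bool" where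
  "abelian_subvariety sc L B \<longleftrightarrow> subgroup B (torus L) \<and> irreducible_subvariety sc L B"


subsection \<open>Holomorphic 1-forms\<close>

text \<open>
  Via the quotient map every tangent space of \<open>A\<close> is identified with \<open>V\<close>. The derivative of a local
  lift of \<open>f\<close> at \<open>x\<close> depends only on the point \<open>proj L x\<close>, because two lifts differ locally by a
  constant in \<open>L\<close>; so the description below is unique.
\<close>

definition differential ::
    "(complex \<Rightarrow> 'v::real_normed_vector \<Rightarrow> 'v) \<Rightarrow> 'v set \<Rightarrow> ('v set \<Rightarrow> 'v set)
      \<Rightarrow> 'v set \<Rightarrow> 'v \<Rightarrow> 'v" where
  "differential sc L f P =
     (THE D. \<exists>x U F. proj L x = P \<and> x \<in> U \<and> local_lift sc L f U F \<and> (F has_derivative D) (at x))"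

text \<open>
  \<open>H\<^sup>1\<^sup>,\<^sup>0(A)\<close> is the Dolbeault group \<open>H\<^sup>0(A, \<Omega>\<^sup>1)\<close> of global holomorphic 1-forms. A form assigns to
  each point a complex-linear functional on the tangent space; it is set to \<open>0\<close> outside the carrier
  so that equality of forms is equality of functions.
\<close>

definition H10 ::
    "(complex \<Rightarrow> 'v::real_normed_vector \<Rightarrow> 'v) \<Rightarrow> 'v set \<Rightarrow> ('v set \<Rightarrow> 'v \<Rightarrow> complex) set" where
  "H10 sc L =
     {\<omega>. (\<forall>P\<in>carrier (torus L). Vector_Spaces.linear sc (*) (\<omega> P)) \<and>
         (\<forall>v. holomorphic_map sc (*) UNIV (\<lambda>x. \<omega> (proj L x) v)) \<and>
         (\<forall>P. P \<notin> carrier (torus L) \<longrightarrow> \<omega> P = (\<lambda>v. 0))}"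

definition pullback ::
    "(complex \<Rightarrow> 'v::real_normed_vector \<Rightarrow> 'v) \<Rightarrow> 'v set \<Rightarrow> ('v set \<Rightarrow> 'v set)
      \<Rightarrow> ('v set \<Rightarrow> 'v \<Rightarrow> complex) \<Rightarrow> 'v set \<Rightarrow> 'v \<Rightarrow> complex" where
  "pullback sc L f \<omega> =
     (\<lambda>P v. if P \<in> carrier (torus L) then \<omega> (f P) (differential sc L f P v) else 0)"

definition eigenvalue_on_H10 ::
    "(complex \<Rightarrow> 'v::real_normed_vector \<Rightarrow> 'v) \<Rightarrow> 'v set \<Rightarrow> ('v set \<Rightarrow> 'v set) \<Rightarrow> complex \<Rightarrow> bool" where
  "eigenvalue_on_H10 sc L f c \<longleftrightarrow>
     (\<exists>\<omega>\<in>H10 sc L. \<omega> \<noteq> (\<lambda>P v. 0) \<and> pullback sc L f \<omega> = (\<lambda>P v. c * \<omega> P v))"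

definition root_of_unity :: "complex \<Rightarrow> bool" where
  "root_of_unity c \<longleftrightarrow> (\<exists>n::nat. n > 0 \<and> c ^ n = 1)"

end

theory Submission
  imports Defs "HOL-Complex_Analysis.Conformal_Mappings"
begin

text \<open>
  An isogeny of \<open>V/L\<close> lifts to an injective complex-linear map \<open>D\<close> of \<open>V\<close> with \<open>D L \<subseteq> L\<close>, and all
  three conditions are equivalent to: some power \<open>D\<^sup>k\<close>, \<open>k \<ge> 1\<close>, fixes a nonzero vector \<open>v\<close>.

  For an injective linear \<open>N\<close> with \<open>N L \<subseteq> L\<close>, the set \<open>N\<^sup>-\<^sup>1 L / L\<close> is finite, because it embeds into
  the intersection of \<open>L\<close> with the image of a compact fundamental domain. With
  \<open>N = D\<^sup>m - D\<^sup>n\<close> this shows that without such a \<open>v\<close> every preperiodic point is torsion; conversely, if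
  \<open>v\<close> exists, the points of the real line through \<open>v\<close> are preperiodic, but only countably many of
  them are torsion.

  The image of \<open>ker (D\<^sup>k - 1)\<close> in the torus is an irreducible subvariety by the identity theorem on
  complex lines. On the other hand, if \<open>D\<^sup>k - 1\<close> is injective, every set of fixed points of \<open>f\<^sup>k\<close> is
  discrete, so all its subsets are closed subvarieties and it is irreducible only if it is a point.

  By Liouville, holomorphic 1-forms are constant, so \<open>f\<^sup>*\<close> is the transpose of \<open>D\<close>. A functional
  invariant under \<open>D\<^sup>k\<close> is the mean of its projections to the eigenspaces of \<open>D\<close> for the \<open>k\<close>-th roots of unity.
\<close>

section \<open>Linear algebra\<close>

text \<open>Sums of two compact sets are compact, so induction on \<open>C\<close> works. The result
  serves for the faces of a cube and for the parallelepiped over a basis taken from the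
  lattice.\<close>

lemma compact_combinations:
  fixes C :: "'v::real_normed_vector set"
  assumes "finite C" and "\<And>b. b \<in> C \<Longrightarrow> compact (I b)"
  shows "compact {\<Sum>b\<in>C. u b *\<^sub>R b | u. \<forall>b\<in>C. u b \<in> I b}"
  using assms
proof (induction C rule: finite_induct)
  case empty
  have "{\<Sum>b\<in>{}. u b *\<^sub>R b | u. \<forall>b\<in>{}. u b \<in> I b} = {0::'v}" by auto
  then show ?case by (metis compact_sing)
next
  case (insert a C)
  let ?T = "{\<Sum>b\<in>C. u b *\<^sub>R b | u. \<forall>b\<in>C. u b \<in> I b}"
  have "compact ((\<lambda>t. t *\<^sub>R a) ` I a)"
    using insert.prems by (intro compact_continuous_image continuous_intros) auto
  moreover have "compact ?T" using insert by auto
  ultimately have "compact {x + y |x y. x \<in> (\<lambda>t. t *\<^sub>R a) ` I a \<and> y \<in> ?T}"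
    by (rule compact_sums)
  also have "{x + y |x y. x \<in> (\<lambda>t. t *\<^sub>R a) ` I a \<and> y \<in> ?T}
     = {\<Sum>b\<in>insert a C. u b *\<^sub>R b | u. \<forall>b\<in>insert a C. u b \<in> I b}" (is "?l = ?r")
  proof
    show "?l \<subseteq> ?r"
    proof
      fix z assume "z \<in> ?l"
      then obtain t u where t: "t \<in> I a" "\<forall>b\<in>C. u b \<in> I b" "z = t *\<^sub>R a + (\<Sum>b\<in>C. u b *\<^sub>R b)"
        by blast
      have "(\<Sum>b\<in>C. (u(a := t)) b *\<^sub>R b) = (\<Sum>b\<in>C. u b *\<^sub>R b)"
        using insert.hyps by (intro sum.cong) auto
      then have "z = (\<Sum>b\<in>insert a C. (u(a := t)) b *\<^sub>R b)"
        using t insert.hyps by simp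
      then show "z \<in> ?r" using t by (intro CollectI exI[of _ "u(a := t)"]) auto
    qed
    show "?r \<subseteq> ?l" using insert.hyps by fastforce
  qed
  finally show ?case .
qed

text \<open>In finite dimension the coordinates are bounded by a multiple of any norm. This makes
  the linear maps below continuous, and differentiable with themselves as derivative, although
  \<open>'v\<close> is only a normed space.\<close>

lemma bounded_linear_if_finite_span:
  fixes g :: "'v::real_normed_vector \<Rightarrow> 'w::real_normed_vector"
  assumes "finite B" "span B = (UNIV :: 'v set)" "linear g"
  shows "bounded_linear g"
proof -
  obtain C where C: "C \<subseteq> B" "independent C" "B \<subseteq> span C"
    using maximal_independent_subset by blast
  have spC: "span C = UNIV"
    using C(3) assms(2) span_mono span_span by (metis top.extremum_uniqueI)
  have finC: "finite C" using C(1) assms(1) finite_subset by blast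
  \<comment> \<open>Scaled by the inverse of its largest coordinate, a nonzero vector lies on a face of the cube
    spanned by \<open>C\<close>; the faces are compact and miss \<open>0\<close>, which bounds the coordinates by the norm.\<close>
  define I where "I a b = (if b = a then {-1, 1} else {-1..1::real})" for a b :: 'v
  define face where "face a = {\<Sum>b\<in>C. u b *\<^sub>R b | u. \<forall>b\<in>C. u b \<in> I a b}" for a
  have "\<exists>d>0. \<forall>x\<in>face a. d \<le> norm x" if "a \<in> C" for a
  proof -
    have "compact (face a)" unfolding face_def
      by (intro compact_combinations finC) (auto simp: I_def)
    \<comment> \<open>On this face the coordinate of \<open>a\<close> is 1 or -1, whereas
      independence of \<open>C\<close> would force it to be 0.\<close>
    moreover have "0 \<notin> face a"
    proof
      assume "0 \<in> face a"
      then obtain u where u: "\<forall>b\<in>C. u b \<in> I a b" "(\<Sum>b\<in>C. u b *\<^sub>R b) = 0"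
        unfolding face_def by auto
      then have "u a = 0" using C(2) finC that by (metis independent_explicit_finite_subsets order_refl)
      with u that show False by (auto simp: I_def)
    qed
    ultimately have "open (- face a)" "0 \<in> - face a" by (auto dest: compact_imp_closed)
    then obtain d where "d > 0" "ball 0 d \<subseteq> - face a" by (meson openE)
    then show ?thesis by (intro exI[of _ d]) (auto simp: subset_iff not_less)
  qed
  then obtain d where d: "\<And>a. a \<in> C \<Longrightarrow> d a > 0" "\<And>a x. a \<in> C \<Longrightarrow> x \<in> face a \<Longrightarrow> d a \<le> norm x"
    by metis
  \<comment> \<open>The added 1 keeps the minimum meaningful when \<open>C\<close> is empty.\<close>
  define c where "c = Min (insert 1 (d ` C))"
  have c0: "c > 0" unfolding c_def using d finC by (subst Min_gr_iff) auto
  have cd: "c \<le> d a" if "a \<in> C" for a unfolding c_def using that finC by (intro Min_le) auto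
  interpret g: linear g by fact
  have "norm (g x) \<le> norm x * ((\<Sum>b\<in>C. norm (g b)) / c)" for x
  proof (cases "x = 0")
    case True
    then show ?thesis by (simp add: g.zero)
  next
    case False
    have "x \<in> span C" using spC by simp
    then obtain u where u: "x = (\<Sum>b\<in>C. u b *\<^sub>R b)" using span_finite[OF finC] by auto
    have "C \<noteq> {}" using False u by auto
    then obtain a where a: "a \<in> C" "\<And>b. b \<in> C \<Longrightarrow> \<bar>u b\<bar> \<le> \<bar>u a\<bar>"
      using finC ex_is_arg_min_if_finite[of C "\<lambda>b. - \<bar>u b\<bar>"]
      by (auto simp: is_arg_min_def not_less)
    let ?m = "\<bar>u a\<bar>"
    have m: "?m > 0"
    proof (rule ccontr)
      assume "\<not> ?m > 0"
      then have "u b = 0" if "b \<in> C" for b using a(2)[OF that] by auto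
      then show False using False u by simp
    qed
    have "x /\<^sub>R ?m = (\<Sum>b\<in>C. (u b / ?m) *\<^sub>R b)"
      unfolding u by (simp add: scaleR_sum_right divide_inverse mult.commute)
    moreover have "u b / ?m \<in> I a b" if "b \<in> C" for b
      using a(2)[OF that] m by (auto simp: I_def field_simps abs_if split: if_splits)
    ultimately have "x /\<^sub>R ?m \<in> face a" unfolding face_def by (intro CollectI exI[of _ "\<lambda>b. u b / ?m"]) auto
    then have "c \<le> norm (x /\<^sub>R ?m)" using d(2)[OF a(1)] cd[OF a(1)] by fastforce
    then have mc: "?m \<le> norm x / c" using m c0 by (simp add: field_simps)
    have "norm (g x) = norm (\<Sum>b\<in>C. u b *\<^sub>R g b)" unfolding u by (simp add: g.sum g.scale)
    also have "\<dots> \<le> (\<Sum>b\<in>C. ?m * norm (g b))"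
      by (intro sum_norm_le) (simp add: a(2) mult_right_mono)
    also have "\<dots> = ?m * (\<Sum>b\<in>C. norm (g b))" by (simp add: sum_distrib_left)
    also have "\<dots> \<le> norm x / c * (\<Sum>b\<in>C. norm (g b))"
      using mc by (intro mult_right_mono sum_nonneg) auto
    finally show ?thesis by simp
  qed
  then show ?thesis by (intro bounded_linear_intro[where K = "(\<Sum>b\<in>C. norm (g b)) / c"]) (auto simp: g.add g.scale)
qed

lemma vector_space_mult: "vector_space ((*) :: complex \<Rightarrow> complex \<Rightarrow> complex)"
  by unfold_locales (auto simp: algebra_simps)

text \<open>For \<open>i > 0\<close> this is a geometric sum with ratio \<open>w ^ i\<close>,
  distinct from 1, and its numerator vanishes. This orthogonality later recovers a functional from
  its eigencomponents.\<close>

lemma sum_powers_root_of_unity: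
  fixes w :: complex
  assumes "w ^ k = 1" "\<And>i. 0 < i \<Longrightarrow> i < k \<Longrightarrow> w ^ i \<noteq> 1" "i < k"
  shows "(\<Sum>j<k. (w ^ j) ^ i) = (if i = 0 then of_nat k else 0)"
proof (cases "i = 0")
  case False
  have "(\<Sum>j<k. (w ^ j) ^ i) = (\<Sum>j<k. (w ^ i) ^ j)" by (simp add: mult.commute flip: power_mult)
  also have "\<dots> = ((w ^ i) ^ k - 1) / (w ^ i - 1)"
    using assms(2)[of i] assms(3) False by (intro geometric_sum) auto
  also have "(w ^ i) ^ k = 1" using assms(1) by (metis mult.commute power_mult power_one)
  finally show ?thesis using False by simp
qed simp

section \<open>Complex tori\<close>

lemma comm_group_additive: "comm_group (additive_group :: 'v::real_normed_vector monoid)"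
  by (rule comm_groupI) (auto simp: additive_group_def add.assoc add.commute intro: exI[of _ "- _"])

locale complex_torus =
  fixes sc :: "complex \<Rightarrow> 'v::real_normed_vector \<Rightarrow> 'v" and L :: "'v set"
  assumes fin_dim: "fin_dim_complex_space sc" and lattice: "is_lattice L"
begin

lemma vector_space_sc: "vector_space sc"
  and sc_of_real: "sc (complex_of_real r) x = r *\<^sub>R x"
  using fin_dim unfolding fin_dim_complex_space_def by auto

sublocale V: vector_space sc by (rule vector_space_sc)

section \<open>The lattice and a compact fundamental domain\<close>

lemma zero_in_L: "0 \<in> L"
  and add_in_L: "x \<in> L \<Longrightarrow> y \<in> L \<Longrightarrow> x + y \<in> L"
  and uminus_in_L: "x \<in> L \<Longrightarrow> - x \<in> L"
  and L_discrete: "discrete L"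
  and span_L: "span L = UNIV"
proof -
  have S: "subgroup L additive_group" using lattice by (simp add: is_lattice_def)
  show "0 \<in> L" "x \<in> L \<Longrightarrow> y \<in> L \<Longrightarrow> x + y \<in> L"
    using subgroup.one_closed[OF S] subgroup.m_closed[OF S] by (auto simp: additive_group_def)
  have "inv\<^bsub>additive_group\<^esub> x = - x"
    using comm_group.axioms(2)[OF comm_group_additive]
    by (intro group.inv_equality) (auto simp: additive_group_def)
  then show "x \<in> L \<Longrightarrow> - x \<in> L" using subgroup.m_inv_closed[OF S] by metis
  show "discrete L" "span L = UNIV" using lattice by (auto simp: is_lattice_def)
qed

lemma diff_in_L: "x \<in> L \<Longrightarrow> y \<in> L \<Longrightarrow> x - y \<in> L"
  using add_in_L[of x "- y"] uminus_in_L by simp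

lemma sum_in_L: "(\<And>i. i \<in> A \<Longrightarrow> g i \<in> L) \<Longrightarrow> sum g A \<in> L"
  by (induction A rule: infinite_finite_induct) (auto simp: zero_in_L add_in_L)

lemma scaleR_nat_in_L: "x \<in> L \<Longrightarrow> real n *\<^sub>R x \<in> L"
  by (induction n) (auto simp: zero_in_L add_in_L algebra_simps)

lemma scaleR_int_in_L: "x \<in> L \<Longrightarrow> of_int n *\<^sub>R x \<in> L"
  by (cases n rule: int_cases4) (use scaleR_nat_in_L uminus_in_L in \<open>force+\<close>)

lemma L_separated:
  obtains e where "e > 0" "\<And>x. x \<in> L \<Longrightarrow> norm x < e \<Longrightarrow> x = 0"
proof -
  have "\<exists>e>0. \<forall>y\<in>L. dist 0 y < e \<longrightarrow> y = 0"
    using L_discrete zero_in_L unfolding discrete_def isolated_in_dist_Ex_iff by fastforce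
  then show ?thesis using that by auto
qed

text \<open>Differences of lattice points are lattice points, so the gap around 0 is a gap around
  every point of \<open>L\<close>.\<close>

lemma L_uniform_discrete: "uniform_discrete L"
proof -
  obtain e where e: "e > 0" "\<And>x. x \<in> L \<Longrightarrow> norm x < e \<Longrightarrow> x = 0" using L_separated by blast
  show ?thesis unfolding uniform_discrete_def
    using e diff_in_L by (intro exI[of _ e]) (metis dist_norm eq_iff_diff_eq_0)
qed

lemma closed_L: "closed L" using L_uniform_discrete uniform_discrete_imp_closed by blast

text \<open>An infinite subset of a compact set has a limit point, which uniform discreteness rules
  out.\<close>

lemma finite_compact_Int_L:
  assumes "compact K" shows "finite (K \<inter> L)"
proof -
  have "compact (K \<inter> L)" using assms closed_L by (rule compact_Int_closed)
  moreover have "\<not> x islimpt (K \<inter> L)" for x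
    using L_uniform_discrete uniform_discrete_subset discrete_imp_not_islimpt unfolding uniform_discrete_def
    by (metis Int_iff)
  ultimately show ?thesis by (metis compact_eq_Bolzano_Weierstrass order_refl)
qed

lemma sc_Re_Im: "sc z b = Re z *\<^sub>R b + Im z *\<^sub>R sc \<i> b"
proof -
  have "sc z b = sc (of_real (Re z) + of_real (Im z) * \<i>) b"
    by (subst complex_eq[of z]) (simp add: mult.commute)
  also have "\<dots> = Re z *\<^sub>R b + Im z *\<^sub>R sc \<i> b"
    by (simp only: V.scale_left_distrib sc_of_real flip: V.scale_scale)
  finally show ?thesis .
qed

lemma real_fin_dim: "\<exists>B. finite B \<and> span B = (UNIV :: 'v set)"
proof -
  obtain B where B: "finite B" "V.span B = UNIV"
    using fin_dim unfolding fin_dim_complex_space_def by auto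
  have "x \<in> span (B \<union> sc \<i> ` B)" for x
  proof -
    have "x \<in> V.span B" using B by simp
    then obtain u where u: "x = (\<Sum>b\<in>B. sc (u b) b)" using V.span_finite[OF B(1)] by auto
    have "sc (u b) b \<in> span (B \<union> sc \<i> ` B)" if "b \<in> B" for b
      using that unfolding sc_Re_Im[of "u b"] by (auto intro!: span_add span_scale intro: span_base)
    then show ?thesis unfolding u by (intro span_sum)
  qed
  then show ?thesis using B(1) by (intro exI[of _ "B \<union> sc \<i> ` B"]) auto
qed

lemma linear_imp_bounded_linear:
  fixes g :: "'v \<Rightarrow> 'w::real_normed_vector"
  assumes "linear g" shows "bounded_linear g"
  using real_fin_dim bounded_linear_if_finite_span assms by blast

text \<open>Since \<open>L\<close> spans, it contains a real basis \<open>C\<close>. Subtracting the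
  integer parts of the coordinates is a translation by \<open>L\<close> and leads into the
  parallelepiped over \<open>C\<close>. As \<open>C\<close> may generate only a sublattice,
  \<open>K\<close> can contain several representatives of a coset.\<close>

lemma compact_fundamental_domain:
  obtains K where "compact K" "\<And>x. \<exists>l\<in>L. x - l \<in> K"
proof -
  obtain C where C: "C \<subseteq> L" "independent C" "L \<subseteq> span C"
    using maximal_independent_subset by blast
  have spC: "span C = UNIV"
    using C(3) span_L span_mono span_span by (metis top.extremum_uniqueI)
  obtain B where B: "finite B" "span B = (UNIV :: 'v set)" using real_fin_dim by blast
  have finC: "finite C" using independent_span_bound[OF B(1) C(2)] B by auto
  let ?K = "{\<Sum>b\<in>C. u b *\<^sub>R b | u. \<forall>b\<in>C. u b \<in> {0..1::real}}"
  have "compact ?K" by (intro compact_combinations finC) auto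
  moreover have "\<exists>l\<in>L. x - l \<in> ?K" for x
  proof -
    have "x \<in> span C" using spC by simp
    then obtain u where u: "x = (\<Sum>b\<in>C. u b *\<^sub>R b)" using span_finite[OF finC] by auto
    have "(\<Sum>b\<in>C. of_int \<lfloor>u b\<rfloor> *\<^sub>R b) \<in> L" using C(1) by (intro sum_in_L scaleR_int_in_L) auto
    moreover have "x - (\<Sum>b\<in>C. of_int \<lfloor>u b\<rfloor> *\<^sub>R b) = (\<Sum>b\<in>C. frac (u b) *\<^sub>R b)"
      unfolding u by (simp add: frac_def sum_subtractf algebra_simps)
    moreover have "(\<Sum>b\<in>C. frac (u b) *\<^sub>R b) \<in> ?K"
      by (intro CollectI exI[of _ "\<lambda>b. frac (u b)"]) (auto simp: frac_lt_1 less_imp_le)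
    ultimately show ?thesis by (intro bexI[of _ "\<Sum>b\<in>C. of_int \<lfloor>u b\<rfloor> *\<^sub>R b"]) (simp_all only:)
  qed
  ultimately show ?thesis by (rule that)
qed

section \<open>The quotient group in terms of representatives\<close>

lemma proj_eq_iff: "proj L x = proj L y \<longleftrightarrow> x - y \<in> L"
proof
  assume *: "proj L x = proj L y"
  have "x \<in> proj L x" using zero_in_L by (auto simp: proj_def r_coset_def additive_group_def)
  then have "x \<in> proj L y" using * by simp
  then show "x - y \<in> L" by (auto simp: proj_def r_coset_def additive_group_def)
next
  assume *: "x - y \<in> L"
  have "z \<in> proj L x \<longleftrightarrow> z - x \<in> L" for x z
    by (force simp: proj_def r_coset_def additive_group_def)
  moreover have "z - x = (z - y) - (x - y)" "z - y = (z - x) + (x - y)" for z by auto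
  ultimately show "proj L x = proj L y" using * add_in_L diff_in_L by (metis subsetI subset_antisym)
qed

lemma carrier_torus: "carrier (torus L) = range (proj L)"
  by (auto simp: torus_def carrier_FactGroup additive_group_def proj_def)

lemma proj_in_carrier: "proj L x \<in> carrier (torus L)" by (simp add: carrier_torus)

lemma one_torus: "\<one>\<^bsub>torus L\<^esub> = proj L 0"
  by (auto simp: torus_def proj_def r_coset_def additive_group_def)

lemma additive_normal: "L \<lhd> additive_group"
  using lattice unfolding comm_group.normal_iff_subgroup[OF comm_group_additive]
  by (simp add: is_lattice_def)

lemma mult_torus: "proj L x \<otimes>\<^bsub>torus L\<^esub> proj L y = proj L (x + y)"
  using normal.rcos_sum[OF additive_normal, of x y]
  by (auto simp: torus_def proj_def additive_group_def)

lemma pow_torus: "proj L x [^]\<^bsub>torus L\<^esub> (n::nat) = proj L (real n *\<^sub>R x)"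
proof (induction n)
  case 0
  then show ?case by (simp add: one_torus)
next
  case (Suc n)
  then show ?case by (simp add: mult_torus algebra_simps)
qed

lemma group_torus: "group (torus L)"
  unfolding torus_def by (rule normal.factorgroup_is_group[OF additive_normal])

lemma inv_torus: "inv\<^bsub>torus L\<^esub> (proj L x) = proj L (- x)"
  using group_torus by (intro group.inv_equality) (auto simp: mult_torus one_torus proj_in_carrier)

lemma proj_in_Tors_iff: "proj L x \<in> Tors L \<longleftrightarrow> (\<exists>n>0. real n *\<^sub>R x \<in> L)"
  by (auto simp: Tors_def proj_in_carrier pow_torus one_torus proj_eq_iff)

section \<open>Complex-linear maps and functionals\<close>

abbreviation "clinear \<equiv> Vector_Spaces.linear sc sc"
abbreviation "cfunctional \<equiv> Vector_Spaces.linear sc ((*) :: complex \<Rightarrow> complex \<Rightarrow> complex)"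

lemma clinear_iff:
  "clinear g \<longleftrightarrow> (\<forall>x y. g (x + y) = g x + g y) \<and> (\<forall>c x. g (sc c x) = sc c (g x))"
  using vector_space_sc by (auto simp: Vector_Spaces.linear_iff)

lemma cfunctional_iff:
  "cfunctional g \<longleftrightarrow> (\<forall>x y. g (x + y) = g x + g y) \<and> (\<forall>c x. g (sc c x) = c * g x)"
  using vector_space_sc vector_space_mult by (auto simp: Vector_Spaces.linear_iff)

lemma bounded_linear_clinear: "clinear g \<Longrightarrow> bounded_linear g"
  by (intro linear_imp_bounded_linear linearI) (simp_all add: clinear_iff flip: sc_of_real)

lemma bounded_linear_cfunctional: "cfunctional g \<Longrightarrow> bounded_linear g"
  by (intro linear_imp_bounded_linear linearI)
    (simp_all add: cfunctional_iff scaleR_conv_of_real flip: sc_of_real)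

lemma clinear_diff: "clinear g \<Longrightarrow> clinear h \<Longrightarrow> clinear (\<lambda>x. g x - h x)"
  by (auto simp: clinear_iff V.scale_right_diff_distrib)

lemma clinear_funpow: "clinear g \<Longrightarrow> clinear (g ^^ k)"
  by (induction k) (auto simp: clinear_iff)

lemma cfunctional_compose: "cfunctional h \<Longrightarrow> clinear g \<Longrightarrow> cfunctional (\<lambda>x. h (g x))"
  by (auto simp: clinear_iff cfunctional_iff)

lemma clinear_inj_iff:
  assumes "clinear g" shows "inj g \<longleftrightarrow> (\<forall>x. g x = 0 \<longrightarrow> x = 0)"
proof -
  interpret g: Vector_Spaces.linear sc sc g by fact
  show ?thesis by (rule g.inj_iff_eq_0)
qed

lemma bounded_linear_sc_left: "bounded_linear (\<lambda>z. sc z b)"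
proof -
  have "bounded_linear (\<lambda>z. Re z *\<^sub>R b + Im z *\<^sub>R sc \<i> b)"
    by (intro bounded_linear_add bounded_linear_scaleR_const bounded_linear_Re bounded_linear_Im)
  moreover have "(\<lambda>z. sc z b) = (\<lambda>z. Re z *\<^sub>R b + Im z *\<^sub>R sc \<i> b)"
    by (rule ext) (rule sc_Re_Im)
  ultimately show ?thesis by (simp only:)
qed

lemma complex_basis:
  obtains B where "finite B" "V.independent B" "V.span B = UNIV"
proof -
  obtain B where B: "finite B" "V.span B = UNIV"
    using fin_dim unfolding fin_dim_complex_space_def by auto
  obtain C where C: "C \<subseteq> B" "V.independent C" "B \<subseteq> V.span C"
    using V.maximal_independent_subset by blast
  have "V.span C = UNIV" using B C(3) by (metis V.span_mono V.span_span top.extremum_uniqueI)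
  then show ?thesis using that[of C] C finite_subset[OF C(1) B(1)] by blast
qed

lemma clinear_inj_iff_surj:
  assumes "clinear g" shows "inj g \<longleftrightarrow> surj g"
proof -
  obtain B where B: "finite B" "V.independent B" "V.span B = UNIV" by (rule complex_basis)
  interpret finite_dimensional_vector_space sc B using B by unfold_locales
  show ?thesis using linear_inj_imp_surj linear_surj_imp_inj assms by blast
qed

text \<open>Coordinates in a complex basis do this. They turn a vector equation into the finitely
  many scalar equations that \<open>closed_subvariety\<close> asks for.\<close>

lemma finite_separating_functionals:
  obtains \<Phi> where "finite \<Phi>" "\<And>\<phi>. \<phi> \<in> \<Phi> \<Longrightarrow> cfunctional \<phi>" "\<And>x. (\<And>\<phi>. \<phi> \<in> \<Phi> \<Longrightarrow> \<phi> x = 0) \<Longrightarrow> x = 0"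
proof -
  obtain B where B: "finite B" "V.independent B" "V.span B = UNIV" by (rule complex_basis)
  let ?\<phi> = "\<lambda>b x. V.representation B x b"
  have "cfunctional (?\<phi> b)" for b
    using B by (auto simp: cfunctional_iff V.representation_add V.representation_scale)
  moreover have "x = 0" if "\<And>b. b \<in> B \<Longrightarrow> ?\<phi> b x = 0" for x
  proof -
    have "x = (\<Sum>b\<in>B. sc (?\<phi> b x) b)"
      using B V.sum_representation_eq[of B x B] by simp
    also have "\<dots> = 0" using that by simp
    finally show ?thesis .
  qed
  ultimately show ?thesis using that[of "?\<phi> ` B"] B(1) by blast
qed

text \<open>Adjoin a vector \<open>v\<close> outside the range to a basis of the range, and
  prescribe the value 1 at \<open>v\<close> and 0 on that basis. For \<open>g\<close> the difference
  of \<open>D ^^ k\<close> and the identity, this gives a functional invariant under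
  \<open>D ^^ k\<close>.\<close>

lemma annihilating_functional:
  assumes "clinear g" "\<not> surj g"
  obtains \<phi> where "cfunctional \<phi>" "\<phi> \<noteq> (\<lambda>x. 0)" "\<And>x. \<phi> (g x) = 0"
proof -
  interpret g: Vector_Spaces.linear sc sc g by fact
  interpret P: vector_space_pair sc "(*) :: complex \<Rightarrow> complex \<Rightarrow> complex"
    by (intro vector_space_pair.intro vector_space_sc vector_space_mult)
  have sub: "V.subspace (range g)" using g.subspace_image V.subspace_UNIV by blast
  obtain C where C: "C \<subseteq> range g" "V.independent C" "range g \<subseteq> V.span C"
    using V.maximal_independent_subset by blast
  have spC: "V.span C = range g" using C sub by (metis V.span_minimal subset_antisym)
  obtain v where v: "v \<notin> range g" using assms(2) by blast
  have "V.independent (insert v C)" using C(2) v spC by (simp add: V.independent_insertI)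
  then obtain \<phi> where phi: "cfunctional \<phi>" "\<forall>x\<in>insert v C. \<phi> x = (if x = v then 1 else 0)"
    using P.linear_independent_extend[of "insert v C" "\<lambda>x. if x = v then 1 else 0"] by auto
  interpret phi: Vector_Spaces.linear sc "(*)" \<phi> by (rule phi)
  have "v \<notin> C" using C(1) v by blast
  then have "\<phi> x = 0" if "x \<in> C" for x using phi(2) that by auto
  then have "\<phi> x = 0" if "x \<in> V.span C" for x using phi.eq_0_on_span that by blast
  then have "\<phi> (g x) = 0" for x using spC by blast
  moreover have "\<phi> v = 1" using phi(2) by auto
  ultimately show ?thesis using that[of \<phi>] phi(1) by (metis zero_neq_one)
qed

section \<open>Closed and irreducible subvarieties\<close>

text \<open>Restriction to complex lines gives access to the one-variable identity theorem and to
  Liouville's theorem.\<close>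

lemma holomorphic_map_on_line:
  assumes h: "holomorphic_map sc (*) U h" and "open S" and S: "\<And>z. z \<in> S \<Longrightarrow> a + sc z b \<in> U"
  shows "(\<lambda>z. h (a + sc z b)) holomorphic_on S"
proof -
  have "\<exists>d. ((\<lambda>z. h (a + sc z b)) has_field_derivative d) (at z)" if "z \<in> S" for z
  proof -
    have "a + sc z b \<in> U" using S that by blast
    then obtain D where D: "(h has_derivative D) (at (a + sc z b))" "cfunctional D"
      using h unfolding holomorphic_map_def by metis
    have "((\<lambda>z. a + sc z b) has_derivative (\<lambda>z. sc z b)) (at z)"
      using bounded_linear_imp_has_derivative[OF bounded_linear_sc_left]
      by (auto intro!: derivative_eq_intros)
    from has_derivative_compose[OF this D(1)]
    have "((\<lambda>z. h (a + sc z b)) has_derivative (\<lambda>z. D (sc z b))) (at z)" .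
    moreover have "(\<lambda>z. D (sc z b)) = (\<lambda>z. D b * z)"
      using D(2) by (simp add: cfunctional_iff mult.commute)
    ultimately show ?thesis by (auto simp: has_field_derivative_def)
  qed
  then show ?thesis
    by (metis \<open>open S\<close> field_differentiable_at_within field_differentiable_def holomorphic_on_def)
qed

text \<open>The identity theorem along a line: the limit points of the trace of \<open>Z\<close> on
  the line form a set that is closed, open and nonempty, hence all of the complex plane.\<close>

lemma islimpt_closed_subvariety_on_line:
  assumes Z: "closed_subvariety sc L Z" and z: "z islimpt {z. proj L (a + sc z b) \<in> Z}"
  shows "proj L (a + sc w b) \<in> Z"
proof -
  let ?g = "\<lambda>z. a + sc z b" and ?T = "{z. proj L (a + sc z b) \<in> Z}"
  let ?A = "{z. z islimpt ?T}"
  have cont: "continuous_on UNIV ?g"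
    by (intro continuous_intros linear_continuous_on bounded_linear_sc_left)
  \<comment> \<open>The local equations at a limit point, restricted to the line, vanish on a set
    accumulating there, hence on a whole disc. The disc contains its centre, so limit points also
    belong to the trace.\<close>
  have nbhd: "\<exists>r>0. ball z r \<subseteq> ?T" if z: "z \<in> ?A" for z
  proof -
    obtain U E where UE: "?g z \<in> U" "open U" "\<forall>h\<in>E. holomorphic_map sc (*) U h"
      "\<forall>y\<in>U. proj L y \<in> Z \<longleftrightarrow> (\<forall>h\<in>E. h y = (0::complex))"
      using Z unfolding closed_subvariety_def by metis
    have "open (?g -` U)" using cont UE(2) by (simp add: continuous_on_open_vimage)
    then obtain r where r: "r > 0" "ball z r \<subseteq> ?g -` U" using UE(1) by (metis openE vimage_eq)
    have "h (?g w) = 0" if h: "h \<in> E" and w: "w \<in> ball z r" for h w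
    proof (rule analytic_continuation[where f = "\<lambda>z. h (?g z)" and S = "ball z r" and U = "?T \<inter> ball z r" and \<xi> = z])
      show "(\<lambda>z. h (?g z)) holomorphic_on ball z r"
        using UE(3) h r(2) by (intro holomorphic_map_on_line) auto
      show "z islimpt ?T \<inter> ball z r"
        using z r(1) by (metis centre_in_ball inf_commute islimpt_Int_eventually mem_Collect_eq open_ball eventually_at_in_open')
      show "h (?g u) = 0" if "u \<in> ?T \<inter> ball z r" for u
        using that r(2) UE(4) h by blast
    qed (use w r(1) in auto)
    then have "ball z r \<subseteq> ?T" using UE(4) r(2) by blast
    then show ?thesis using r(1) by blast
  qed
  have "open ?A"
  proof (rule Topological_Spaces.openI)
    fix z assume "z \<in> ?A"
    then obtain r where r: "r > 0" "ball z r \<subseteq> ?T" using nbhd by blast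
    have "ball z r \<subseteq> ?A"
      using r(2) by (metis (no_types, lifting) islimpt_subset mem_Collect_eq open_ball open_imp_islimpt subsetI)
    then show "\<exists>T. open T \<and> z \<in> T \<and> T \<subseteq> ?A" using r(1) by (metis centre_in_ball open_ball)
  qed
  moreover have "closed ?A" by (rule closed_limpts)
  ultimately have "?A = UNIV" using z clopen[of ?A] by blast
  then show ?thesis using nbhd[of w] by (metis UNIV_I centre_in_ball mem_Collect_eq subsetD)
qed

text \<open>Since \<open>N\<close> maps \<open>S\<close> into the discrete set \<open>L\<close>,
  near any point \<open>x\<close> only the fibre of \<open>N\<close> through \<open>x\<close> can
  meet \<open>S\<close>. Being stable under the kernel of \<open>N\<close>, the set \<open>S\<close>
  contains this fibre or misses it, so locally it is an affine subspace or empty. The lemma serves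
  both for kernels and, with \<open>N\<close> injective, for arbitrary sets of fixed points.\<close>

lemma closed_subvariety_saturated:
  assumes N: "clinear N" and NS: "\<And>x. x \<in> S \<Longrightarrow> N x \<in> L"
    and SL: "\<And>x l. x \<in> S \<Longrightarrow> l \<in> L \<Longrightarrow> x + l \<in> S"
    and Sker: "\<And>x w. x \<in> S \<Longrightarrow> N w = 0 \<Longrightarrow> x + w \<in> S"
  shows "closed_subvariety sc L (proj L ` S)"
proof -
  interpret N: bounded_linear N by (rule bounded_linear_clinear[OF N])
  have mem: "proj L y \<in> proj L ` S \<longleftrightarrow> y \<in> S" for y
  proof
    assume "proj L y \<in> proj L ` S"
    then obtain x where "x \<in> S" "y - x \<in> L" by (auto simp: proj_eq_iff)
    then show "y \<in> S" using SL[of x "y - x"] by simp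
  qed blast
  obtain \<Phi> where Phi: "finite \<Phi>" "\<And>\<phi>. \<phi> \<in> \<Phi> \<Longrightarrow> cfunctional \<phi>"
    "\<And>x. (\<And>\<phi>. \<phi> \<in> \<Phi> \<Longrightarrow> \<phi> x = 0) \<Longrightarrow> x = 0" using finite_separating_functionals by blast
  have "\<exists>U E. x \<in> U \<and> open U \<and> finite E \<and> (\<forall>h\<in>E. holomorphic_map sc (*) U h) \<and>
        (\<forall>y\<in>U. proj L y \<in> proj L ` S \<longleftrightarrow> (\<forall>h\<in>E. h y = (0::complex)))" for x
  proof -
    \<comment> \<open>On \<open>U\<close> the value of \<open>N\<close> avoids every lattice point
      other than \<open>N x\<close>, so \<open>N y\<close> in \<open>L\<close> forces
      \<open>N y = N x\<close>.\<close>
    define U where "U = N -` (- (L - {N x}))"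
    have "closed (L - {N x})"
      by (rule uniform_discrete_imp_closed) (use L_uniform_discrete uniform_discrete_subset in blast)
    then have "open U" unfolding U_def
      by (intro open_vimage open_Compl N.continuous_on continuous_on_id)
    then have U: "open U" "x \<in> U" by (simp_all add: U_def)
    have NU: "N y = N x" if "y \<in> U" "y \<in> S" for y using that NS U_def by auto
    show ?thesis
    proof (cases "x \<in> S")
      case True
      let ?E = "(\<lambda>\<phi> y. \<phi> (N (y - x))) ` \<Phi>"
      have "holomorphic_map sc (*) U (\<lambda>y. \<phi> (N (y - x)))" if "\<phi> \<in> \<Phi>" for \<phi>
        unfolding holomorphic_map_def
      proof (intro conjI ballI exI U)
        have c: "cfunctional (\<lambda>y. \<phi> (N y))" using cfunctional_compose[OF Phi(2)[OF that] N] .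
        then interpret c: bounded_linear "\<lambda>y. \<phi> (N y)" by (rule bounded_linear_cfunctional)
        show "((\<lambda>y. \<phi> (N (y - x))) has_derivative (\<lambda>y. \<phi> (N y))) (at y)" for y
          by (rule c.has_derivative) (auto intro!: derivative_eq_intros)
        show "cfunctional (\<lambda>y. \<phi> (N y))" by (rule c)
      qed
      moreover have "y \<in> S \<longleftrightarrow> (\<forall>\<phi>\<in>\<Phi>. \<phi> (N (y - x)) = 0)" if "y \<in> U" for y
      proof
        assume "y \<in> S"
        then have "N (y - x) = 0" using NU[OF that] by (simp add: N.diff)
        then show "\<forall>\<phi>\<in>\<Phi>. \<phi> (N (y - x)) = 0"
          using Phi(2) bounded_linear_cfunctional linear_0 bounded_linear.linear by metis
      next
        assume "\<forall>\<phi>\<in>\<Phi>. \<phi> (N (y - x)) = 0"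
        then have "N (y - x) = 0" using Phi(3) by blast
        then show "y \<in> S" using Sker[OF True, of "y - x"] by simp
      qed
      ultimately show ?thesis using U Phi(1) mem
        by (intro exI[of _ U] exI[of _ ?E]) auto
    next
      case False
      \<comment> \<open>Here \<open>S\<close> misses \<open>U\<close>, since a common point would
        differ from \<open>x\<close> by a kernel vector. The constant 1 is an equation without
        zeros.\<close>
      have "holomorphic_map sc (*) U (\<lambda>y. 1)"
        unfolding holomorphic_map_def using U by (auto intro!: exI[of _ "\<lambda>y. 0"] simp: cfunctional_iff)
      moreover have "y \<notin> S" if "y \<in> U" for y
        using Sker[of y "x - y"] NU[OF that] False by (auto simp: N.diff)
      ultimately show ?thesis using U mem
        by (intro exI[of _ U] exI[of _ "{\<lambda>y. 1}"]) auto
    qed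
  qed
  moreover have "proj L ` S \<subseteq> carrier (torus L)" by (auto simp: proj_in_carrier)
  ultimately show ?thesis unfolding closed_subvariety_def by blast
qed

text \<open>The complex line joining two kernel points stays in the kernel. If two closed
  subvarieties cover the image, the trace of one of them on this line accumulates at 0, so that one
  contains the whole line.\<close>

lemma irreducible_subvariety_proj_kernel:
  assumes N: "clinear N" and NL: "\<And>l. l \<in> L \<Longrightarrow> N l \<in> L"
  shows "irreducible_subvariety sc L (proj L ` {w. N w = 0})" (is "irreducible_subvariety sc L ?B")
  unfolding irreducible_subvariety_def
proof (intro conjI allI impI)
  interpret N: bounded_linear N by (rule bounded_linear_clinear[OF N])
  \<comment> \<open>The full preimage of \<open>?B\<close> in the vector space, which is what the
    criterion for closedness needs.\<close>
  let ?S = "{w + l | w l. N w = 0 \<and> l \<in> L}"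
  have "closed_subvariety sc L (proj L ` ?S)"
  proof (rule closed_subvariety_saturated[OF N])
    show "N x \<in> L" if "x \<in> ?S" for x using that NL by (auto simp: N.add)
    show "x + l \<in> ?S" if "x \<in> ?S" "l \<in> L" for x l
      using that add_in_L by (auto simp: add.assoc) (metis)
    show "x + w \<in> ?S" if "x \<in> ?S" "N w = 0" for x w
    proof -
      from that obtain w' l where "x = w' + l" "N w' = 0" "l \<in> L" by blast
      then show ?thesis using that(2)
        by (intro CollectI exI[of _ "w' + w"] exI[of _ l]) (simp add: N.add algebra_simps)
    qed
  qed
  moreover have "proj L ` ?S = ?B"
  proof
    show "proj L ` ?S \<subseteq> ?B"
    proof
      fix P assume "P \<in> proj L ` ?S"
      then obtain w l where "P = proj L (w + l)" "N w = 0" "l \<in> L" by blast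
      moreover have "proj L (w + l) = proj L w" using \<open>l \<in> L\<close> by (simp add: proj_eq_iff)
      ultimately show "P \<in> ?B" by blast
    qed
    show "?B \<subseteq> proj L ` ?S" using zero_in_L by (intro image_mono) (force intro: exI[of _ 0])
  qed
  ultimately show "closed_subvariety sc L ?B" by simp
  show "?B \<noteq> {}" using N.zero by blast
  fix Z1 Z2 assume Z: "closed_subvariety sc L Z1 \<and> closed_subvariety sc L Z2 \<and> ?B = Z1 \<union> Z2"
  show "?B = Z1 \<or> ?B = Z2"
  proof (rule ccontr)
    assume "\<not> (?B = Z1 \<or> ?B = Z2)"
    then obtain w1 w2 where w: "N w1 = 0" "N w2 = 0" "proj L w1 \<notin> Z1" "proj L w2 \<notin> Z2"
      using Z by blast
    \<comment> \<open>The parameters 0 and 1 give \<open>w1\<close>, whose image is outside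
      \<open>Z1\<close>, and \<open>w2\<close>, whose image is outside \<open>Z2\<close>; so neither
      set can contain the line.\<close>
    let ?b = "w2 - w1"
    have 0: "N (w1 + sc z ?b) = 0" for z
      using N w(1,2) by (simp add: N.add N.diff clinear_iff)
    have "{z. proj L (w1 + sc z ?b) \<in> Z1} \<union> {z. proj L (w1 + sc z ?b) \<in> Z2} = UNIV"
      using 0 Z by blast
    moreover have "(0::complex) islimpt UNIV" by simp
    ultimately have "0 islimpt {z. proj L (w1 + sc z ?b) \<in> Z1} \<or> 0 islimpt {z. proj L (w1 + sc z ?b) \<in> Z2}"
      by (metis islimpt_Un)
    then show False
      using islimpt_closed_subvariety_on_line[of Z1 0 w1 ?b 0] islimpt_closed_subvariety_on_line[of Z2 0 w1 ?b 1]
        Z w(3,4) by auto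
  qed
qed

section \<open>Finiteness modulo the lattice and non-torsion points\<close>

text \<open>Pigeonhole form of the finiteness of the preimage of \<open>L\<close> modulo
  \<open>L\<close>: each \<open>y k\<close> is moved into \<open>K\<close> by a lattice vector,
  which keeps its image under \<open>N\<close> in \<open>L\<close>, and only finitely many points of
  \<open>K\<close> have such an image.\<close>

lemma congruent_pair_of_injective_preimage:
  fixes y :: "nat \<Rightarrow> 'v"
  assumes N: "clinear N" "inj N" and NL: "\<And>l. l \<in> L \<Longrightarrow> N l \<in> L" and y: "\<And>k. N (y k) \<in> L"
  obtains j k where "j < k" "y k - y j \<in> L"
proof -
  interpret N: bounded_linear N by (rule bounded_linear_clinear[OF N(1)])
  obtain K where K: "compact K" "\<And>x. \<exists>l\<in>L. x - l \<in> K"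
    using compact_fundamental_domain by blast
  let ?T = "{y \<in> K. N y \<in> L}"
  have "compact (N ` K)" using K(1) by (intro compact_continuous_image N.continuous_on continuous_on_id)
  then have "finite (N ` K \<inter> L)" by (rule finite_compact_Int_L)
  then have "finite (N ` ?T)" by (rule finite_subset[rotated]) auto
  then have finT: "finite ?T" by (rule finite_imageD) (use N(2) in \<open>auto intro: inj_on_subset\<close>)
  have "\<forall>k. \<exists>l\<in>L. y k - l \<in> K" using K(2) by blast
  then obtain l where l: "\<And>k. l k \<in> L" "\<And>k. y k - l k \<in> K" by metis
  have "y k - l k \<in> ?T" for k
    using l NL y by (auto simp: N.diff intro!: diff_in_L)
  then have "range (\<lambda>k. y k - l k) \<subseteq> ?T" by blast
  then have "\<not> inj (\<lambda>k. y k - l k)"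
    using finT finite_subset range_inj_infinite by metis
  then obtain j k where jk: "j < k" "y j - l j = y k - l k"
    unfolding inj_def by (metis linorder_neqE_nat)
  then have "y k - y j = l k - l j" by (simp add: algebra_simps)
  then show ?thesis using that[OF jk(1)] diff_in_L l(1) by simp
qed

text \<open>Each bounded interval contains finitely many \<open>t\<close> with
  \<open>t *\<^sub>R v\<close> in \<open>L\<close>, so these \<open>t\<close> are countable, and so
  are their quotients by natural numbers. The reals are not.\<close>

lemma real_line_not_torsion:
  assumes "v \<noteq> 0"
  obtains t :: real where "\<And>n::nat. n > 0 \<Longrightarrow> real n *\<^sub>R t *\<^sub>R v \<notin> L"
proof -
  let ?G = "{t::real. t *\<^sub>R v \<in> L}"
  have "finite (?G \<inter> {- real n..real n})" for n
  proof -
    have "compact ((\<lambda>t. t *\<^sub>R v) ` {- real n..real n})"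
      by (intro compact_continuous_image continuous_intros) auto
    then have "finite ((\<lambda>t. t *\<^sub>R v) ` {- real n..real n} \<inter> L)" by (rule finite_compact_Int_L)
    then have "finite ((\<lambda>t. t *\<^sub>R v) ` (?G \<inter> {- real n..real n}))"
      by (rule finite_subset[rotated]) auto
    then show ?thesis by (rule finite_imageD) (use assms in \<open>auto simp: inj_on_def\<close>)
  qed
  then have "countable (\<Union>n. ?G \<inter> {- real n..real n})" by (intro countable_UN[OF _ countable_finite]) auto
  moreover have "?G \<subseteq> (\<Union>n. ?G \<inter> {- real n..real n})"
  proof
    fix t assume t: "t \<in> ?G"
    obtain n where "\<bar>t\<bar> \<le> real n" using real_arch_simple by blast
    then show "t \<in> (\<Union>n. ?G \<inter> {- real n..real n})" using t by (auto intro!: exI[of _ n])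
  qed
  ultimately have "countable ?G" using countable_subset by blast
  \<comment> \<open>Every parameter of a torsion point is such a quotient. The index
    \<open>n = 0\<close> contributes only 0, because division by 0 yields 0.\<close>
  then have "countable (\<Union>n. (\<lambda>s. s / real n) ` ?G)" by auto
  then obtain t where t: "t \<notin> (\<Union>n. (\<lambda>s. s / real n) ` ?G)"
    using uncountable_UNIV_real by (metis UNIV_eq_I)
  have "real n *\<^sub>R t *\<^sub>R v \<notin> L" if "n > 0" for n
  proof
    assume "real n *\<^sub>R t *\<^sub>R v \<in> L"
    then have "t = (real n * t) / real n" "real n * t \<in> ?G" using that by auto
    then show False using t by blast
  qed
  then show ?thesis using that by blast
qed

section \<open>Constancy of holomorphic 1-forms\<close>

text \<open>All values are taken on a compact set, so \<open>h\<close> is bounded. Liouville's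
  theorem on the complex line through 0 and \<open>x\<close> compares the parameters 1 and
  0.\<close>

lemma periodic_holomorphic_imp_constant:
  assumes h: "holomorphic_map sc (*) UNIV h" and per: "\<And>x l. l \<in> L \<Longrightarrow> h (x + l) = h x"
  shows "h x = h 0"
proof -
  obtain K where K: "compact K" "\<And>x. \<exists>l\<in>L. x - l \<in> K"
    using compact_fundamental_domain by blast
  have "\<And>x. isCont h x" using h has_derivative_continuous unfolding holomorphic_map_def by blast
  then have "continuous_on K h" by (simp add: continuous_at_imp_continuous_on)
  then have "bounded (h ` K)" using K(1) compact_continuous_image compact_imp_bounded by blast
  moreover have "h y \<in> h ` K" for y
  proof -
    obtain l where "l \<in> L" "y - l \<in> K" using K(2) by blast
    moreover from this have "h y = h (y - l)" using per[of l "y - l"] by simp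
    ultimately show ?thesis by blast
  qed
  ultimately have "bounded (range (\<lambda>z. h (0 + sc z x)))" by (metis (no_types, lifting) bounded_subset image_subsetI)
  moreover have "(\<lambda>z. h (0 + sc z x)) holomorphic_on UNIV"
    by (rule holomorphic_map_on_line[OF h]) auto
  ultimately have "(\<lambda>z. h (0 + sc z x)) constant_on UNIV" by (intro Liouville_theorem)
  then have "h (0 + sc 1 x) = h (0 + sc 0 x)" unfolding constant_on_def by (metis UNIV_I)
  then show ?thesis by simp
qed

lemma H10_eq_constant:
  assumes "\<omega> \<in> H10 sc L" shows "\<omega> (proj L x) = \<omega> (proj L 0)"
proof
  fix v
  have "holomorphic_map sc (*) UNIV (\<lambda>x. \<omega> (proj L x) v)" using assms by (simp add: H10_def)
  moreover have "\<omega> (proj L (x + l)) v = \<omega> (proj L x) v" if "l \<in> L" for x l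
    using that proj_eq_iff[of "x + l" x] by simp
  ultimately show "\<omega> (proj L x) v = \<omega> (proj L 0) v" by (rule periodic_holomorphic_imp_constant)
qed

section \<open>The linear lift of an isogeny\<close>

text \<open>A local lift near 0 is additive up to \<open>L\<close>, and exactly additive on a small
  ball because \<open>L\<close> is discrete. Additivity and differentiability at 0 make it equal to
  its derivative there, and the homomorphism property extends this to the whole torus.\<close>

lemma isogeny_lift:
  assumes "isogeny sc L f"
  obtains D where "clinear D" "inj D" "\<And>x. f (proj L x) = proj L (D x)"
proof -
  have f_add: "f (proj L (x + y)) = f (proj L x) \<otimes>\<^bsub>torus L\<^esub> f (proj L y)" for x y
    using assms hom_mult[of f "torus L" "torus L" "proj L x" "proj L y"]
    by (simp add: isogeny_def proj_in_carrier mult_torus)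
  obtain U F where UF: "0 \<in> U" "local_lift sc L f U F"
    using assms unfolding isogeny_def morphism_def by blast
  then have "open U" and F: "\<And>y. y \<in> U \<Longrightarrow> f (proj L y) = proj L (F y)"
    unfolding local_lift_def holomorphic_map_def by auto
  obtain D where D: "(F has_derivative D) (at 0)" "clinear D"
    using UF unfolding local_lift_def holomorphic_map_def by blast
  interpret D: bounded_linear D by (rule bounded_linear_clinear[OF D(2)])
  \<comment> \<open>A homomorphism fixes the neutral element, so subtracting \<open>F 0\<close>
    gives another lift of \<open>f\<close>, now vanishing at 0.\<close>
  have F0: "F 0 \<in> L"
    using f_add[of 0 0] F[OF UF(1)] by (simp add: mult_torus proj_eq_iff uminus_in_L) (metis minus_minus uminus_in_L)
  define G where "G x = F x - F 0" for x
  have G: "f (proj L x) = proj L (G x)" if "x \<in> U" for x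
    using F[OF that] F0 by (simp add: G_def proj_eq_iff)
  have G_deriv: "(G has_derivative D) (at 0)" unfolding G_def by (auto intro!: derivative_eq_intros D(1))
  have G0: "G 0 = 0" by (simp add: G_def)
  obtain e where e: "e > 0" "\<And>l. l \<in> L \<Longrightarrow> norm l < e \<Longrightarrow> l = 0" using L_separated by blast
  have "isCont G 0" using G_deriv has_derivative_continuous by blast
  \<comment> \<open>The additivity defect is a combination of three values of \<open>G\<close>; with
    each below \<open>e / 3\<close> it is a lattice vector shorter than \<open>e\<close>, hence
    0.\<close>
  then obtain d where d: "d > 0" "\<And>x. norm x < d \<Longrightarrow> norm (G x) < e / 3"
    using e(1) G0 unfolding continuous_at_eps_delta by (metis dist_norm diff_zero divide_pos_pos zero_less_numeral)
  obtain d' where d': "d' > 0" "ball 0 d' \<subseteq> U" using \<open>open U\<close> UF(1) openE by blast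
  define r where "r = min d d'"
  have r: "r > 0" using d(1) d'(1) by (simp add: r_def)
  have rU: "x \<in> U" and rG: "norm (G x) < e / 3" if "norm x < r" for x
    using that d(2)[of x] d'(2) by (auto simp: r_def)
  have G_add: "G (x + y) = G x + G y" if "norm x < r" "norm y < r" "norm (x + y) < r" for x y
  proof -
    have "proj L (G (x + y)) = proj L (G x + G y)"
      using f_add[of x y] G rU that by (simp add: mult_torus)
    then have "G (x + y) - (G x + G y) \<in> L" by (simp add: proj_eq_iff)
    moreover have "norm (G (x + y) - (G x + G y)) < e"
    proof -
      have "norm (G (x + y) - (G x + G y)) \<le> norm (G (x + y)) + (norm (G x) + norm (G y))"
        by (meson norm_triangle_ineq norm_triangle_ineq4 add_left_mono order_trans)
      also have "\<dots> < e" using rG[OF that(1)] rG[OF that(2)] rG[OF that(3)] by simp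
      finally show ?thesis .
    qed
    ultimately show ?thesis using e(2) by (metis eq_iff_diff_eq_0)
  qed
  \<comment> \<open>By additivity \<open>G x = n G (x/n)\<close>, which tends to the derivative at \<open>0\<close> in direction \<open>x\<close>.\<close>
  have G_D: "G x = D x" if x: "norm x < r" for x
  proof -
    have "G (real k *\<^sub>R y) = real k *\<^sub>R G y" if "norm (real k *\<^sub>R y) < r" for k y
      using that
    proof (induction k)
      case (Suc k)
      have "norm (real k *\<^sub>R y) \<le> norm (real (Suc k) *\<^sub>R y)"
        unfolding norm_scaleR by (intro mult_right_mono) auto
      then have k: "norm (real k *\<^sub>R y) < r" using Suc.prems by (rule le_less_trans)
      show ?case
      proof (cases "k = 0")
        case False
        then have "1 * norm y \<le> norm (real k *\<^sub>R y)"
          unfolding norm_scaleR by (intro mult_right_mono) auto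
        then have "norm y < r" using k by linarith
        then have "G (real k *\<^sub>R y + y) = G (real k *\<^sub>R y) + G y"
          using k Suc.prems by (intro G_add) (auto simp: algebra_simps)
        then show ?thesis using Suc.IH[OF k] by (simp add: algebra_simps)
      qed simp
    qed (simp add: G0)
    then have scale: "G x = real n *\<^sub>R G (x /\<^sub>R real n)" if "n > 0" for n :: nat
      using that x by (metis divideR_right less_numeral_extra(3) of_nat_0_less_iff)
    have bound: "norm (G x - D x) \<le> \<epsilon> * norm x" if eps: "\<epsilon> > 0" for \<epsilon>
    proof -
      obtain \<delta> where delta: "\<delta> > 0" "\<And>y. norm y < \<delta> \<Longrightarrow> norm (G y - D y) \<le> \<epsilon> * norm y"
        using G_deriv eps unfolding has_derivative_at_alt G0 by (metis diff_zero)
      obtain n :: nat where n: "norm x / \<delta> < real n" using reals_Archimedean2 by blast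
      moreover have "0 \<le> norm x / \<delta>" using delta(1) by simp
      ultimately have n0: "real n > 0" by linarith
      have "norm (x /\<^sub>R real n) < \<delta>" using n n0 delta(1) by (simp add: field_simps)
      from delta(2)[OF this] have "norm (G (x /\<^sub>R real n) - D (x /\<^sub>R real n)) \<le> \<epsilon> * norm x / real n"
        using n0 by (simp add: field_simps)
      moreover have "G x - D x = real n *\<^sub>R (G (x /\<^sub>R real n) - D (x /\<^sub>R real n))"
        using scale[of n] n0 by (simp add: D.scaleR scaleR_diff_right)
      then have "norm (G x - D x) = real n * norm (G (x /\<^sub>R real n) - D (x /\<^sub>R real n))" by simp
      ultimately show ?thesis using n0 by (simp add: pos_le_divide_eq mult.commute)
    qed
    show ?thesis
    proof (rule ccontr)
      assume "G x \<noteq> D x"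
      then have pos: "norm (G x - D x) > 0" by simp
      \<comment> \<open>This value of \<open>\<epsilon>\<close> contradicts the bound; the added 1
        makes the inequality strict and covers \<open>x = 0\<close>.\<close>
      then have "norm (G x - D x) / (norm x + 1) > 0"
        by (intro divide_pos_pos add_nonneg_pos) auto
      from bound[OF this] have "norm (G x - D x) * (norm x + 1) \<le> norm (G x - D x) * norm x"
        by (simp add: pos_le_divide_eq add_nonneg_pos)
      then show False using pos by (simp add: algebra_simps)
    qed
  qed
  \<comment> \<open>Every \<open>x\<close> is a natural multiple of a vector in the small ball,
    where the lift is already known to be \<open>D\<close>.\<close>
  have f_proj: "f (proj L x) = proj L (D x)" for x
  proof -
    have scale: "f (proj L (real n *\<^sub>R y)) = proj L (real n *\<^sub>R D y)" if "norm y < r" for y and n :: nat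
    proof (induction n)
      case 0
      then show ?case using G[OF UF(1)] G0 by simp
    next
      case (Suc n)
      then show ?case using f_add[of y "real n *\<^sub>R y"] G[OF rU[OF that]] G_D[OF that]
        by (simp add: mult_torus algebra_simps)
    qed
    obtain n :: nat where n: "norm x / r < real n" using reals_Archimedean2 by blast
    moreover have "0 \<le> norm x / r" using r by simp
    ultimately have n0: "real n > 0" by linarith
    have "norm (x /\<^sub>R real n) < r" using n n0 r by (simp add: field_simps)
    from scale[OF this, of n] show ?thesis using n0 by (simp add: D.scaleR)
  qed
  \<comment> \<open>A nonzero vector killed by \<open>D\<close> would put the multiples of a
    non-torsion point into the finite kernel of \<open>f\<close>.\<close>
  have "inj D"
  proof (subst clinear_inj_iff[OF D(2)], intro allI impI, rule ccontr)
    fix v assume v: "D v = 0" "v \<noteq> 0"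
    obtain t :: real where t: "\<And>n::nat. n > 0 \<Longrightarrow> real n *\<^sub>R t *\<^sub>R v \<notin> L"
      using real_line_not_torsion[OF v(2)] by blast
    let ?P = "\<lambda>n::nat. proj L (real n *\<^sub>R t *\<^sub>R v)"
    have "range ?P \<subseteq> kernel (torus L) (torus L) f"
      using v(1) by (auto simp: kernel_def proj_in_carrier f_proj one_torus D.scaleR)
    moreover have "inj ?P"
    proof (rule linorder_injI)
      fix m n :: nat assume "m < n"
      then have "real n *\<^sub>R t *\<^sub>R v - real m *\<^sub>R t *\<^sub>R v = real (n - m) *\<^sub>R t *\<^sub>R v"
        by (metis of_nat_diff less_imp_le scaleR_diff_left)
      moreover have "real (n - m) *\<^sub>R t *\<^sub>R v \<notin> L" using \<open>m < n\<close> by (intro t) simp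
      ultimately have "?P n \<noteq> ?P m" unfolding proj_eq_iff by metis
      then show "?P m \<noteq> ?P n" by metis
    qed
    ultimately show False
      using assms finite_subset range_inj_infinite unfolding isogeny_def by metis
  qed
  then show ?thesis using that D(2) f_proj by blast
qed

end

section \<open>Isogenies\<close>

locale lifted_isogeny = complex_torus sc L
  for sc :: "complex \<Rightarrow> 'v::real_normed_vector \<Rightarrow> 'v" and L :: "'v set" +
  fixes f :: "'v set \<Rightarrow> 'v set" and D :: "'v \<Rightarrow> 'v"
  assumes D_clinear: "Vector_Spaces.linear sc sc D" and D_inj: "inj D"
    and f_proj: "\<And>x. f (proj L x) = proj L (D x)"
begin

sublocale D: bounded_linear D by (rule bounded_linear_clinear[OF D_clinear])

text \<open>Equivalently, some eigenvalue of \<open>D\<close> is a root of unity.\<close>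

definition fixes_vector :: bool where
  "fixes_vector \<longleftrightarrow> (\<exists>k\<ge>1. \<exists>v. v \<noteq> 0 \<and> (D ^^ k) v = v)"

lemma funpow_proj: "(f ^^ k) (proj L x) = proj L ((D ^^ k) x)"
  by (induction k) (auto simp: f_proj)

text \<open>Lattice vectors represent the same coset as 0, and \<open>f\<close> is a function of
  cosets, so \<open>D\<close> preserves \<open>L\<close>.\<close>

lemma funpow_in_L: "l \<in> L \<Longrightarrow> (D ^^ k) l \<in> L"
proof (induction k)
  case (Suc k)
  then show ?case using f_proj[of "(D ^^ k) l"] f_proj[of 0] proj_eq_iff[of "(D ^^ k) l" 0]
      proj_eq_iff[of "D ((D ^^ k) l)" 0] by (simp add: D.zero)
qed simp

section \<open>Preperiodic points and torsion points\<close>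

text \<open>If \<open>n\<close> kills the point, it kills all its iterates. The pigeonhole lemma
  with \<open>N\<close> multiplication by \<open>n\<close> makes two iterates coincide.\<close>

lemma Tors_subset_Preper: "Tors L \<subseteq> Preper L f"
proof
  fix P assume "P \<in> Tors L"
  then obtain x where x: "P = proj L x" "proj L x \<in> Tors L" by (auto simp: Tors_def carrier_torus)
  then obtain n where n: "n > 0" "real n *\<^sub>R x \<in> L" using proj_in_Tors_iff by blast
  let ?N = "\<lambda>x::'v. real n *\<^sub>R x"
  have N: "clinear ?N" by (auto simp: clinear_iff algebra_simps V.scale_left_commute simp flip: sc_of_real)
  have pow: "bounded_linear (D ^^ k)" for k using clinear_funpow[OF D_clinear] bounded_linear_clinear by blast
  have "inj ?N" using n(1) by (intro injI) simp
  moreover have "real n *\<^sub>R (D ^^ k) x \<in> L" for k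
    using funpow_in_L[OF n(2), of k] linear_simps(5)[OF pow, of k] by simp
  ultimately obtain j k where "j < k" "(D ^^ k) x - (D ^^ j) x \<in> L"
    using congruent_pair_of_injective_preimage[OF N _ scaleR_nat_in_L, of "\<lambda>k. (D ^^ k) x"] by blast
  then have "(f ^^ k) P = (f ^^ j) P" by (simp add: x funpow_proj proj_eq_iff)
  then show "P \<in> Preper L f" using \<open>j < k\<close> x by (auto simp: Preper_def proj_in_carrier)
qed

text \<open>Take a preperiodic non-torsion point. All multiples of its representative are mapped
  into \<open>L\<close> by \<open>?N\<close>; were \<open>?N\<close> injective, two of them would be
  congruent modulo \<open>L\<close>, which makes the point torsion.\<close>

lemma fixes_vector_if_Preper_neq_Tors:
  assumes "Preper L f \<noteq> Tors L" shows fixes_vector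
proof -
  obtain x m n where x: "proj L x \<notin> Tors L" "m > n" "(f ^^ m) (proj L x) = (f ^^ n) (proj L x)"
    using assms Tors_subset_Preper by (auto simp: Preper_def carrier_torus)
  let ?N = "\<lambda>x. (D ^^ m) x - (D ^^ n) x"
  have N: "clinear ?N" by (intro clinear_diff clinear_funpow D_clinear)
  interpret N: bounded_linear ?N by (rule bounded_linear_clinear[OF N])
  have "\<not> inj ?N"
  proof
    assume "inj ?N"
    moreover have "?N l \<in> L" if "l \<in> L" for l using that by (intro diff_in_L funpow_in_L)
    moreover have Nx: "?N x \<in> L" using x(3) by (simp add: funpow_proj proj_eq_iff)
    moreover have "?N (real k *\<^sub>R x) \<in> L" for k
      using Nx scaleR_nat_in_L by (simp only: N.scaleR)
    ultimately obtain j k where "j < k" "real k *\<^sub>R x - real j *\<^sub>R x \<in> L"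
      using congruent_pair_of_injective_preimage[OF N, of "\<lambda>k. real k *\<^sub>R x"] by blast
    then have "real (k - j) *\<^sub>R x \<in> L" "k - j > 0" by (simp_all add: of_nat_diff algebra_simps)
    then show False using x(1) proj_in_Tors_iff by blast
  qed
  then obtain v where v: "v \<noteq> 0" "(D ^^ m) v = (D ^^ n) v" using clinear_inj_iff[OF N] by auto
  \<comment> \<open>Injectivity of \<open>D\<close> cancels the preperiod: a preperiodic vector is
    periodic.\<close>
  have "(D ^^ n) ((D ^^ (m - n)) v) = (D ^^ n) v"
    using v(2) x(2) funpow_add[of n "m - n" D] by simp
  then have "(D ^^ (m - n)) v = v" using inj_fn[OF D_inj, of n] by (simp add: inj_eq)
  then show ?thesis using v(1) x(2) unfolding fixes_vector_def by (intro exI[of _ "m - n"]) auto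
qed

lemma Preper_neq_Tors_if_fixes_vector:
  assumes fixes_vector shows "Preper L f \<noteq> Tors L"
proof -
  obtain k v where kv: "k \<ge> 1" "v \<noteq> 0" "(D ^^ k) v = v" using assms by (auto simp: fixes_vector_def)
  obtain t :: real where t: "\<And>n::nat. n > 0 \<Longrightarrow> real n *\<^sub>R t *\<^sub>R v \<notin> L"
    using real_line_not_torsion[OF kv(2)] by blast
  have "bounded_linear (D ^^ k)" using clinear_funpow[OF D_clinear] bounded_linear_clinear by blast
  then have "(D ^^ k) (t *\<^sub>R v) = t *\<^sub>R v" using kv(3) by (simp add: linear_simps)
  then have "(f ^^ k) (proj L (t *\<^sub>R v)) = (f ^^ 0) (proj L (t *\<^sub>R v))" by (simp add: funpow_proj)
  then have "proj L (t *\<^sub>R v) \<in> Preper L f"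
    using kv(1) unfolding Preper_def
    by (intro CollectI conjI exI[of _ k] exI[of _ 0]) (auto simp: proj_in_carrier)
  moreover have "proj L (t *\<^sub>R v) \<notin> Tors L" using t proj_in_Tors_iff by blast
  ultimately show ?thesis by blast
qed

section \<open>Subvarieties fixed by an iterate\<close>

text \<open>If no vector were fixed, every subset of \<open>B\<close> would be a closed subvariety.
  Positive dimension provides two points of \<open>B\<close>, and splitting off one of them
  contradicts irreducibility.\<close>

lemma fixes_vector_if_subvariety_fixed:
  assumes B: "irreducible_subvariety sc L B" "subvariety_dim sc L B > 0"
    and k: "k \<ge> 1" "\<forall>P\<in>B. (f ^^ k) P = P"
  shows fixes_vector
proof -
  \<comment> \<open>Writing the identity as \<open>D ^^ 0\<close> lets the facts on powers of
    \<open>D\<close> apply to both terms.\<close>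
  let ?N = "\<lambda>x. (D ^^ k) x - (D ^^ 0) x"
  have N: "clinear ?N" by (intro clinear_diff clinear_funpow D_clinear)
  interpret N: bounded_linear ?N by (rule bounded_linear_clinear[OF N])
  have "\<not> inj ?N"
  proof
    assume inj: "inj ?N"
    have carrier: "B \<subseteq> carrier (torus L)"
      using B(1) by (simp add: irreducible_subvariety_def closed_subvariety_def)
    have closed: "closed_subvariety sc L Z" if "Z \<subseteq> B" for Z
    proof -
      let ?S = "{x. proj L x \<in> Z}"
      have "closed_subvariety sc L (proj L ` ?S)"
      proof (rule closed_subvariety_saturated[OF N])
        show "?N x \<in> L" if "x \<in> ?S" for x
          using that \<open>Z \<subseteq> B\<close> k(2) funpow_proj[of k x] by (auto simp flip: proj_eq_iff)
        show "x + l \<in> ?S" if "x \<in> ?S" "l \<in> L" for x l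
          using that proj_eq_iff[of "x + l" x] by simp
        show "x + w \<in> ?S" if "x \<in> ?S" "?N w = 0" for x w
          using that inj clinear_inj_iff[OF N] by auto
      qed
      moreover have "proj L ` ?S = Z"
        using \<open>Z \<subseteq> B\<close> carrier by (auto simp: carrier_torus)
      ultimately show ?thesis by simp
    qed
    \<comment> \<open>A positive supremum of chain lengths yields a chain with at least one strict
      inclusion; only its first step is used.\<close>
    obtain n C where n: "n > 0"
      and C: "\<And>i. i \<le> n \<Longrightarrow> irreducible_subvariety sc L (C i) \<and> C i \<subseteq> B"
        "\<And>i. i < n \<Longrightarrow> C i \<subset> C (Suc i)"
    proof -
      obtain e where e: "e \<in> {enat n | n. \<exists>C::nat \<Rightarrow> 'v set set.
        (\<forall>i\<le>n. irreducible_subvariety sc L (C i) \<and> C i \<subseteq> B) \<and> (\<forall>i<n. C i \<subset> C (Suc i))}" "0 < e"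
        using B(2) unfolding subvariety_dim_def less_Sup_iff by blast
      then obtain n where "e = enat n" "\<exists>C::nat \<Rightarrow> 'v set set.
        (\<forall>i\<le>n. irreducible_subvariety sc L (C i) \<and> C i \<subseteq> B) \<and> (\<forall>i<n. C i \<subset> C (Suc i))" by blast
      moreover have "0 < n" using e(2) \<open>e = enat n\<close> by (simp add: zero_enat_def)
      ultimately show ?thesis using that by metis
    qed
    have "C 0 \<noteq> {}" using C(1)[of 0] by (simp add: irreducible_subvariety_def)
    then obtain P where P: "P \<in> C 0" by blast
    obtain Q where Q: "Q \<in> C (Suc 0)" "Q \<notin> C 0" using C(2)[OF n] by blast
    have "P \<in> B" "Q \<in> B" "P \<noteq> Q" using P Q C(1)[of 0] C(1)[of "Suc 0"] n by auto
    then have "B = {P} \<union> (B - {P})" "B \<noteq> {P}" "B \<noteq> B - {P}" by blast+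
    moreover have "closed_subvariety sc L {P}" "closed_subvariety sc L (B - {P})"
      using closed \<open>P \<in> B\<close> by auto
    ultimately show False using B(1) unfolding irreducible_subvariety_def by metis
  qed
  then obtain v where "v \<noteq> 0" "(D ^^ k) v = v" using clinear_inj_iff[OF N] by auto
  then show ?thesis using k(1) unfolding fixes_vector_def by blast
qed

text \<open>The fixed space of \<open>D ^^ k\<close> projects to the required subgroup; the chain
  from the origin to this subgroup shows that its dimension is positive.\<close>

lemma subvariety_fixed_if_fixes_vector:
  assumes fixes_vector
  shows "\<exists>B. abelian_subvariety sc L B \<and> subvariety_dim sc L B > 0 \<and> (\<exists>k\<ge>1. \<forall>P\<in>B. (f ^^ k) P = P)"
proof -
  obtain k v where k: "k \<ge> 1" and v: "v \<noteq> 0" "(D ^^ k) v = v" using assms by (auto simp: fixes_vector_def)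
  let ?N = "\<lambda>x. (D ^^ k) x - (D ^^ 0) x"
  have N: "clinear ?N" by (intro clinear_diff clinear_funpow D_clinear)
  interpret N: bounded_linear ?N by (rule bounded_linear_clinear[OF N])
  let ?W = "{w. ?N w = 0}"
  define B where "B = proj L ` ?W"
  have irr: "irreducible_subvariety sc L B" unfolding B_def
    by (intro irreducible_subvariety_proj_kernel[OF N]) (intro diff_in_L funpow_in_L)
  have add: "x + y \<in> ?W" if "x \<in> ?W" "y \<in> ?W" for x y
    using N.add[of x y] that by simp
  have "subgroup B (torus L)"
  proof (rule group.subgroupI[OF group_torus])
    show "B \<subseteq> carrier (torus L)" by (auto simp: B_def proj_in_carrier)
    show "B \<noteq> {}" using irr by (simp add: irreducible_subvariety_def)
    show "inv\<^bsub>torus L\<^esub> a \<in> B" if a: "a \<in> B" for a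
    proof -
      obtain w where w: "a = proj L w" "?N w = 0" using a by (auto simp: B_def)
      then have "- w \<in> ?W" using N.diff[of 0 w] N.zero by (simp add: eq_neg_iff_add_eq_0)
      then show ?thesis unfolding B_def w(1) inv_torus by (rule imageI)
    qed
    show "a \<otimes>\<^bsub>torus L\<^esub> b \<in> B" if ab: "a \<in> B" "b \<in> B" for a b
    proof -
      obtain x y where "a = proj L x" "b = proj L y" "x \<in> ?W" "y \<in> ?W" using ab by (auto simp: B_def)
      then show ?thesis using add[of x y] unfolding B_def by (simp only: mult_torus) blast
    qed
  qed
  then have "abelian_subvariety sc L B" using irr by (simp add: abelian_subvariety_def)
  moreover have "subvariety_dim sc L B > 0"
  proof -
    \<comment> \<open>The vector \<open>v\<close> itself may lie in \<open>L\<close>; a suitable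
      real multiple gives a point of \<open>B\<close> other than the origin.\<close>
    obtain t :: real where t: "\<And>n::nat. n > 0 \<Longrightarrow> real n *\<^sub>R t *\<^sub>R v \<notin> L"
      using real_line_not_torsion[OF v(1)] by blast
    have "?N v = 0" using v(2) by simp
    then have tv: "t *\<^sub>R v \<in> ?W" using N.scaleR[of t v] by simp
    \<comment> \<open>The origin is the image of the kernel of the identity map, hence irreducible
      by the same lemma.\<close>
    have "clinear (\<lambda>x. x)" by (simp add: clinear_iff)
    from irreducible_subvariety_proj_kernel[OF this]
    have origin: "irreducible_subvariety sc L {proj L 0}" by simp
    have "proj L 0 \<in> B" using N.zero by (auto simp: B_def)
    moreover have "proj L (t *\<^sub>R v) \<noteq> proj L 0" using t[of 1] by (simp add: proj_eq_iff)
    ultimately have "{proj L 0} \<subset> B" using tv by (auto simp: B_def)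
    then have "\<exists>C::nat \<Rightarrow> 'v set set. (\<forall>i\<le>1. irreducible_subvariety sc L (C i) \<and> C i \<subseteq> B)
        \<and> (\<forall>i<1. C i \<subset> C (Suc i))"
      using irr origin by (intro exI[of _ "\<lambda>i. if i = 0 then {proj L 0} else B"]) auto
    then have "enat 1 \<le> subvariety_dim sc L B" unfolding subvariety_dim_def by (intro Sup_upper) blast
    then show ?thesis by (metis enat_0_iff(1) i0_lb leD less_le zero_neq_one)
  qed
  moreover have "\<forall>P\<in>B. (f ^^ k) P = P" by (auto simp: B_def funpow_proj)
  ultimately show ?thesis using k by blast
qed

section \<open>Pullback of 1-forms and its eigenvalues\<close>

lemma differential_eq: "differential sc L f (proj L x) = D"
  unfolding differential_def
proof (rule the_equality)
  have "local_lift sc L f UNIV D"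
    using D_clinear unfolding local_lift_def holomorphic_map_def
    by (auto simp: f_proj intro!: exI[of _ D] bounded_linear_imp_has_derivative D.bounded_linear_axioms)
  then show "\<exists>y U F. proj L y = proj L x \<and> y \<in> U \<and> local_lift sc L f U F \<and> (F has_derivative D) (at y)"
    using bounded_linear_imp_has_derivative[OF D.bounded_linear_axioms] by blast
next
  fix D'
  assume "\<exists>y U F. proj L y = proj L x \<and> y \<in> U \<and> local_lift sc L f U F \<and> (F has_derivative D') (at y)"
  then obtain y U F where y: "y \<in> U" "open U" "\<And>z. z \<in> U \<Longrightarrow> f (proj L z) = proj L (F z)"
    and F: "(F has_derivative D') (at y)"
    unfolding local_lift_def holomorphic_map_def by blast
  have D: "(D has_derivative D) (at y)" by (rule bounded_linear_imp_has_derivative[OF D.bounded_linear_axioms])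
  \<comment> \<open>The difference of two lifts has values in \<open>L\<close> and is continuous at
    \<open>y\<close>, hence constant near \<open>y\<close>, so its derivative there is 0.\<close>
  let ?G = "\<lambda>z. F z - D z"
  have G: "(?G has_derivative (\<lambda>h. D' h - D h)) (at y)" by (intro has_derivative_diff F D)
  have GL: "?G z \<in> L" if "z \<in> U" for z using y(3)[OF that] by (simp add: f_proj flip: proj_eq_iff)
  obtain e where e: "e > 0" "\<And>l. l \<in> L \<Longrightarrow> norm l < e \<Longrightarrow> l = 0" using L_separated by blast
  have "\<forall>\<^sub>F z in at y. dist (?G z) (?G y) < e"
    using has_derivative_continuous[OF G] e(1) by (auto simp: continuous_within dest: tendstoD)
  moreover have "\<forall>\<^sub>F z in at y. z \<in> U" using y(2,1) by (rule eventually_at_in_open')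
  ultimately have "\<forall>\<^sub>F z in at y. ?G z = ?G y"
  proof eventually_elim
    case (elim z)
    then have "?G z - ?G y \<in> L" using y(1) by (intro diff_in_L[OF GL GL])
    then show ?case using e(2)[of "?G z - ?G y"] elim(1) by (simp add: dist_norm)
  qed
  then have "((\<lambda>z. ?G y) has_derivative (\<lambda>h. D' h - D h)) (at y)"
    by (intro has_derivative_transform_eventually[OF G]) auto
  moreover have "((\<lambda>z. ?G y) has_derivative (\<lambda>h. 0)) (at y)" by simp
  ultimately have "(\<lambda>h. D' h - D h) = (\<lambda>h. 0)" by (rule has_derivative_unique)
  then show "D' = D" by (simp add: fun_eq_iff)
qed

text \<open>Forms are constant, so they are determined by their value at the origin. The origin is
  fixed by \<open>f\<close>, and there pullback becomes composition with \<open>D\<close>.\<close>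

lemma eigenvalue_on_H10_iff:
  "eigenvalue_on_H10 sc L f c \<longleftrightarrow> (\<exists>\<phi>. cfunctional \<phi> \<and> \<phi> \<noteq> (\<lambda>v. 0) \<and> (\<forall>v. \<phi> (D v) = c * \<phi> v))"
proof
  assume "eigenvalue_on_H10 sc L f c"
  then obtain \<omega> where w: "\<omega> \<in> H10 sc L" "\<omega> \<noteq> (\<lambda>P v. 0)" "pullback sc L f \<omega> = (\<lambda>P v. c * \<omega> P v)"
    by (auto simp: eigenvalue_on_H10_def)
  let ?\<phi> = "\<omega> (proj L 0)"
  have "cfunctional ?\<phi>" using w(1) by (simp add: H10_def proj_in_carrier)
  moreover have "?\<phi> \<noteq> (\<lambda>v. 0)"
  proof
    assume 0: "?\<phi> = (\<lambda>v. 0)"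
    have "\<omega> P = (\<lambda>v. 0)" for P
    proof (cases "P \<in> carrier (torus L)")
      case True
      then show ?thesis using H10_eq_constant[OF w(1)] 0 by (auto simp: carrier_torus)
    next
      case False
      then show ?thesis using w(1) by (simp add: H10_def)
    qed
    then show False using w(2) by auto
  qed
  moreover have "?\<phi> (D v) = c * ?\<phi> v" for v
    using fun_cong[OF fun_cong[OF w(3), of "proj L 0"], of v]
    by (simp add: pullback_def proj_in_carrier differential_eq f_proj D.zero)
  ultimately show "\<exists>\<phi>. cfunctional \<phi> \<and> \<phi> \<noteq> (\<lambda>v. 0) \<and> (\<forall>v. \<phi> (D v) = c * \<phi> v)" by blast
next
  assume "\<exists>\<phi>. cfunctional \<phi> \<and> \<phi> \<noteq> (\<lambda>v. 0) \<and> (\<forall>v. \<phi> (D v) = c * \<phi> v)"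
  then obtain \<phi> where phi: "cfunctional \<phi>" "\<phi> \<noteq> (\<lambda>v. 0)" "\<And>v. \<phi> (D v) = c * \<phi> v" by blast
  define \<omega> where "\<omega> P = (if P \<in> carrier (torus L) then \<phi> else (\<lambda>v. 0))" for P
  have "holomorphic_map sc (*) UNIV (\<lambda>x. \<phi> v)" for v
    by (auto simp: holomorphic_map_def cfunctional_iff intro!: exI[of _ "\<lambda>v. 0"])
  then have "\<omega> \<in> H10 sc L" using phi(1) by (simp add: H10_def \<omega>_def proj_in_carrier)
  moreover have "\<omega> (proj L 0) \<noteq> (\<lambda>v. 0)" using phi(2) by (simp add: \<omega>_def proj_in_carrier)
  then have "\<omega> \<noteq> (\<lambda>P v. 0)" by metis
  moreover have "pullback sc L f \<omega> = (\<lambda>P v. c * \<omega> P v)"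
    by (intro ext) (auto simp: pullback_def \<omega>_def carrier_torus f_proj differential_eq phi(3))
  ultimately show "eigenvalue_on_H10 sc L f c" unfolding eigenvalue_on_H10_def by blast
qed

text \<open>The eigenfunctional is invariant under \<open>D ^^ k\<close>, so it vanishes on the
  range of \<open>?N\<close>. Thus \<open>?N\<close> is not surjective and, in finite dimension, not
  injective.\<close>

lemma fixes_vector_if_root_of_unity_eigenvalue:
  assumes "eigenvalue_on_H10 sc L f c" "root_of_unity c" shows fixes_vector
proof -
  obtain \<phi> where phi: "cfunctional \<phi>" "\<phi> \<noteq> (\<lambda>v. 0)" "\<And>v. \<phi> (D v) = c * \<phi> v"
    using assms(1) unfolding eigenvalue_on_H10_iff by blast
  obtain k where k: "k > 0" "c ^ k = 1" using assms(2) by (auto simp: root_of_unity_def)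
  have "\<phi> ((D ^^ i) v) = c ^ i * \<phi> v" for i v by (induction i) (auto simp: phi(3))
  then have fixed: "\<phi> ((D ^^ k) v) = \<phi> v" for v using k(2) by simp
  interpret phi: bounded_linear \<phi> by (rule bounded_linear_cfunctional[OF phi(1)])
  let ?N = "\<lambda>x. (D ^^ k) x - (D ^^ 0) x"
  have N: "clinear ?N" by (intro clinear_diff clinear_funpow D_clinear)
  have "\<phi> (?N v) = 0" for v using fixed by (simp add: phi.diff)
  then have "\<not> surj ?N" using phi(2) by (metis (no_types, lifting) ext surj_def)
  then have "\<not> inj ?N" using clinear_inj_iff_surj[OF N] by blast
  then obtain v where "v \<noteq> 0" "(D ^^ k) v = v" using clinear_inj_iff[OF N] by auto
  then show ?thesis using k(1) unfolding fixes_vector_def by (metis Suc_leI One_nat_def)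
qed

text \<open>The operator \<open>?N\<close> is not surjective, which yields a functional invariant
  under \<open>D ^^ k\<close>. One of its components under the cyclic action of \<open>D\<close> is
  nonzero and is the desired eigenfunctional.\<close>

lemma root_of_unity_eigenvalue_if_fixes_vector:
  assumes fixes_vector shows "\<exists>c. eigenvalue_on_H10 sc L f c \<and> root_of_unity c"
proof -
  obtain k v where k: "k \<ge> 1" "v \<noteq> 0" "(D ^^ k) v = v" using assms by (auto simp: fixes_vector_def)
  let ?N = "\<lambda>x. (D ^^ k) x - (D ^^ 0) x"
  have N: "clinear ?N" by (intro clinear_diff clinear_funpow D_clinear)
  have "?N v = 0" using k(3) by simp
  then have "\<not> inj ?N" using k(2) clinear_inj_iff[OF N] by blast
  then obtain \<phi> where phi: "cfunctional \<phi>" "\<phi> \<noteq> (\<lambda>v. 0)" "\<And>v. \<phi> (?N v) = 0"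
    using annihilating_functional[OF N] clinear_inj_iff_surj[OF N] by blast
  interpret phi: bounded_linear \<phi> by (rule bounded_linear_cfunctional[OF phi(1)])
  have fixed: "\<phi> ((D ^^ k) v) = \<phi> v" for v using phi(3)[of v] by (simp add: phi.diff)
  \<comment> \<open>A primitive \<open>k\<close>-th root of unity.\<close>
  define w where "w = exp (2 * of_real pi * \<i> * of_nat 1 / of_nat k)"
  have w_pow: "w ^ i = exp (2 * of_real pi * \<i> * of_nat i / of_nat k)" for i
    unfolding w_def by (simp add: mult_ac flip: exp_of_nat_mult)
  have w_eq_1: "w ^ i = 1 \<longleftrightarrow> k dvd i" for i
    unfolding w_pow using complex_root_unity_eq_1[OF k(1)] by blast
  \<comment> \<open>Up to the factor \<open>k\<close>, the projection of \<open>\<phi>\<close> to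
    the eigenspace of the transpose of \<open>D\<close> for the eigenvalue
    \<open>inverse (w ^ j)\<close>.\<close>
  define \<psi> where "\<psi> j v = (\<Sum>i<k. (w ^ j) ^ i * \<phi> ((D ^^ i) v))" for j v
  have "(\<Sum>j<k. \<psi> j v) = of_nat k * \<phi> v" for v
  proof -
    have "(\<Sum>j<k. \<psi> j v) = (\<Sum>i<k. (\<Sum>j<k. (w ^ j) ^ i) * \<phi> ((D ^^ i) v))"
      unfolding \<psi>_def by (subst sum.swap) (simp add: sum_distrib_right)
    also have "\<dots> = (\<Sum>i<k. if i = 0 then of_nat k * \<phi> v else 0)"
      using w_eq_1 by (intro sum.cong) (auto simp: sum_powers_root_of_unity nat_dvd_not_less)
    also have "\<dots> = of_nat k * \<phi> v" using k(1) by simp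
    finally show ?thesis .
  qed
  moreover obtain u where "\<phi> u \<noteq> 0" using phi(2) by auto
  ultimately have "(\<Sum>j<k. \<psi> j u) \<noteq> 0" using k(1) by simp
  then obtain j where j: "\<psi> j u \<noteq> 0" by (meson sum.neutral)
  have "(w ^ j) ^ k = (w ^ k) ^ j" by (simp add: mult.commute flip: power_mult)
  also have "w ^ k = 1" by (simp add: w_eq_1)
  finally have wj: "(w ^ j) ^ k = 1" by simp
  have "w \<noteq> 0" unfolding w_def by (rule exp_not_eq_zero)
  have pow: "cfunctional (\<lambda>v. \<phi> ((D ^^ i) v))" for i
    by (rule cfunctional_compose[OF phi(1) clinear_funpow[OF D_clinear]])
  have "cfunctional (\<psi> j)"
    using pow unfolding cfunctional_iff \<psi>_def
    by (simp add: sum.distrib sum_distrib_left distrib_left mult.left_commute)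
  moreover have "\<psi> j \<noteq> (\<lambda>v. 0)" using j by metis
  moreover have "\<psi> j (D v) = inverse (w ^ j) * \<psi> j v" for v
  proof -
    let ?t = "\<lambda>i. (w ^ j) ^ i * \<phi> ((D ^^ i) v)"
    have "w ^ j * \<psi> j (D v) = (\<Sum>i<k. ?t (Suc i))"
      unfolding \<psi>_def by (simp add: sum_distrib_left mult.assoc funpow_swap1)
    \<comment> \<open>The shift replaces the term for 0 by the term for \<open>k\<close>; they agree
      because \<open>(w ^ j) ^ k = 1\<close> and \<open>\<phi>\<close> is invariant under
      \<open>D ^^ k\<close>.\<close>
    also have "\<dots> = (\<Sum>i<Suc k. ?t i) - ?t 0" by (subst sum.lessThan_Suc_shift) simp
    also have "\<dots> = \<psi> j v" using wj fixed by (simp add: \<psi>_def)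
    finally show ?thesis using \<open>w \<noteq> 0\<close> by (simp add: field_simps)
  qed
  ultimately have "eigenvalue_on_H10 sc L f (inverse (w ^ j))" unfolding eigenvalue_on_H10_iff by blast
  moreover have "inverse (w ^ j) ^ k = 1" using wj by (simp add: power_inverse)
  then have "root_of_unity (inverse (w ^ j))"
    using k(1) unfolding root_of_unity_def by (intro exI[of _ k]) auto
  ultimately show ?thesis by blast
qed

end

theorem proposition2p5:
  fixes sc :: "complex \<Rightarrow> 'v::real_normed_vector \<Rightarrow> 'v"
    and L :: "'v set"
    and f :: "'v set \<Rightarrow> 'v set"
  assumes "abelian_variety sc L"
    and "isogeny sc L f"
  shows "(Preper L f \<noteq> Tors L \<longleftrightarrow>
           (\<exists>B. abelian_subvariety sc L B \<and> subvariety_dim sc L B > 0 \<and>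
              (\<exists>k\<ge>1. \<forall>P\<in>B. (f ^^ k) P = P)))
       \<and> ((\<exists>B. abelian_subvariety sc L B \<and> subvariety_dim sc L B > 0 \<and>
              (\<exists>k\<ge>1. \<forall>P\<in>B. (f ^^ k) P = P)) \<longleftrightarrow>
           (\<exists>c. eigenvalue_on_H10 sc L f c \<and> root_of_unity c))"
proof -
  interpret complex_torus sc L
    using assms(1) by unfold_locales (auto simp: abelian_variety_def)
  obtain D where D: "clinear D" "inj D" "\<And>x. f (proj L x) = proj L (D x)"
    using isogeny_lift[OF assms(2)] by blast
  interpret lifted_isogeny sc L f D
    by (intro lifted_isogeny.intro lifted_isogeny_axioms.intro complex_torus_axioms D)
  have "Preper L f \<noteq> Tors L \<longleftrightarrow> fixes_vector"
    using fixes_vector_if_Preper_neq_Tors Preper_neq_Tors_if_fixes_vector by blast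
  moreover have "(\<exists>B. abelian_subvariety sc L B \<and> subvariety_dim sc L B > 0 \<and>
      (\<exists>k\<ge>1. \<forall>P\<in>B. (f ^^ k) P = P)) \<longleftrightarrow> fixes_vector"
    using subvariety_fixed_if_fixes_vector fixes_vector_if_subvariety_fixed
    unfolding abelian_subvariety_def by blast
  moreover have "(\<exists>c. eigenvalue_on_H10 sc L f c \<and> root_of_unity c) \<longleftrightarrow> fixes_vector"
    using fixes_vector_if_root_of_unity_eigenvalue root_of_unity_eigenvalue_if_fixes_vector by blast
  ultimately show ?thesis by blast
qed

end
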